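(* Let $\mathcal{H}$ be a Hopf algebra equipped with a modular pair $(\varepsilon,\sigma)$ in involution, and with a $\sigma$-invariant trace $Tr:\mathcal{H}\to k$ such that $Tr(\sigma)\in k$ is invertible; assume moreover that $\mathcal{H}$ is a Hopf $*$-coalgebra with $\sigma^*=\sigma^{-1}$. Then for every $n$, the Hopf-dihedral homology $HC^\pm_n(\mathcal{H};\sigma,\varepsilon)$ is a direct summand of the dihedral homology $HC^\pm_n(\mathcal{H})$ of the algebra $\mathcal{H}$.
   Context: $k$ is a field of characteristic $0$ containing $\mathbb{Q}[\sqrt{-1}]$, with complex conjugation $\lambda\mapsto\overline\lambda$. A Hopf $*$-coalgebra is a Hopf algebra $\mathcal{H}$ with an involution $*$ such that $\Delta(h^* )=h_{(2)}^*\otimes h_{(1)}^*$, $\varepsilon(h^* )=\overline{\varepsilon(h)}$, $(hg)^*=h^*g^*$, $1^*=1$, $(S\circ * )^2=\mathrm{Id}$. The pair $(\varepsilon,\sigma)$ is a modular pair in involution: $\sigma$ group-like and $S^2=\mathrm{Ad}_\sigma$. A $\sigma$-invariant trace is a linear $Tr:\mathcal{H}\to k$ with $Tr(h_{(1)})h_{(2)}=Tr(h)\sigma$ and $Tr(ab)=Tr(ba)$. The algebra $\mathcal{H}$ is a $*$-algebra via $a\mapsto S(a)^*$, and $HC^\pm_\bullet(\mathcal{H})$ is the dihedral homology of the dihedral module $\mathcal{H}^{\otimes\bullet+1}$ (standard cyclic structure with faces multiplying adjacent factors, last face $a_0\otimes\cdots\otimes a_n\mapsto a_na_0\otimes\cdots\otimes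 a_{n-1}$, $\tau_n(a_0\otimes\cdots\otimes a_n)=a_n\otimes a_0\otimes\cdots\otimes a_{n-1}$, and $\omega_n(a_0\otimes\cdots\otimes a_n)=\bar a_0\otimes\bar a_n\otimes\cdots\otimes\bar a_1$ with $\bar a=S(a)^*$). $HC^\pm_\bullet(\mathcal{H};\sigma,\varepsilon)$ is the dihedral homology of the dihedral module $\mathrm{CC}_n(\mathcal{H};\sigma,\varepsilon)=\mathcal{H}^{\otimes n}$ with faces $\partial_0(h^1\otimes\cdots\otimes h^n)=\varepsilon(h^1)h^2\otimes\cdots\otimes h^n$, $\partial_i=h^1\otimes\cdots\otimes h^ih^{i+1}\otimes\cdots\otimes h^n$ ($1\le i\le n-1$), $\partial_n=\varepsilon(h^n)h^1\otimes\cdots\otimes h^{n-1}$; degeneracies inserting $1$; $\tau_n(h^1\otimes\cdots\otimes h^n)=\varepsilon(h^n_{(2)})\sigma S(h^1_{(1)}\cdots h^n_{(1)})\otimes h^1_{(2)}\otimes\cdots\otimes h^{n-1}_{(2)}$; $\omega_n(h^1\otimes\cdots\otimes h^n)=S^{-1}(h^{n*})\otimes\cdots\otimes S^{-1}(h^{1*})$. Here "dihedral homology" means the homology of the $\pm1$-eigenspaces of the involution induced by $\omega$ on the cyclic complex. *)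

theory Defs
  imports Main "HOL-Library.Function_Algebras"
begin

text \<open>A k-vector space with basis 'b is modelled as finitely supported functions 'b => 'k.
  The n-th tensor power is modelled as finitely supported functions on words
  'b list supported on words of length n (basis of H^{tensor n} = words of basis elements).\<close>

definition fsupp :: "('a \<Rightarrow> 'k::zero) \<Rightarrow> 'a set" where
  "fsupp f = {x. f x \<noteq> 0}"

definition fvec :: "('a \<Rightarrow> 'k::zero) set" where
  "fvec = {f. finite (fsupp f)}"

definition bvec :: "'a \<Rightarrow> 'a \<Rightarrow> 'k::{zero,one}" where
  "bvec a = (\<lambda>x. if x = a then 1 else 0)"

definition scal :: "'k::times \<Rightarrow> ('a \<Rightarrow> 'k) \<Rightarrow> 'a \<Rightarrow> 'k" where
  "scal c f = (\<lambda>x. c * f x)"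

definition lext :: "('a \<Rightarrow> 'c \<Rightarrow> 'k::comm_ring_1) \<Rightarrow> ('a \<Rightarrow> 'k) \<Rightarrow> 'c \<Rightarrow> 'k" where
  "lext F x = (\<lambda>c. \<Sum>a\<in>fsupp x. x a * F a c)"

definition alext :: "('k \<Rightarrow> 'k) \<Rightarrow> ('a \<Rightarrow> 'c \<Rightarrow> 'k::comm_ring_1) \<Rightarrow> ('a \<Rightarrow> 'k) \<Rightarrow> 'c \<Rightarrow> 'k" where
  "alext cnj F x = (\<lambda>c. \<Sum>a\<in>fsupp x. cnj (x a) * F a c)"

definition lfun :: "('a \<Rightarrow> 'k::comm_ring_1) \<Rightarrow> ('a \<Rightarrow> 'k) \<Rightarrow> 'k" where
  "lfun f x = (\<Sum>a\<in>fsupp x. x a * f a)"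

definition TP :: "nat \<Rightarrow> ('b list \<Rightarrow> 'k::zero) set" where
  "TP n = {x. finite (fsupp x) \<and> (\<forall>w. x w \<noteq> 0 \<longrightarrow> length w = n)}"

definition tensl :: "('b \<Rightarrow> 'k::comm_ring_1) list \<Rightarrow> 'b list \<Rightarrow> 'k" where
  "tensl hs w = (if length w = length hs then (\<Prod>i<length w. (hs!i) (w!i)) else 0)"

definition tprod :: "('b list \<Rightarrow> 'k::comm_ring_1) \<Rightarrow> ('b list \<Rightarrow> 'k) \<Rightarrow> 'b list \<Rightarrow> 'k" where
  "tprod x y = (\<lambda>w. \<Sum>i\<le>length w. x (take i w) * y (drop i w))"

definition tmap :: "('b \<Rightarrow> 'b list \<Rightarrow> 'k::comm_ring_1) list \<Rightarrow> ('b list \<Rightarrow> 'k) \<Rightarrow> 'b list \<Rightarrow> 'k" where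
  "tmap Fs = lext (\<lambda>w. if length w = length Fs
       then foldr tprod (map2 (\<lambda>F a. F a) Fs w) (bvec []) else 0)"

text \<open>m a b = product of basis vectors a b; u = unit; cm a = coproduct of a (in H (x) H);
  e = counit; S a = antipode of a; st a = star of a (extended antilinearly).\<close>

definition mulH :: "('b \<Rightarrow> 'b \<Rightarrow> 'b \<Rightarrow> 'k::comm_ring_1) \<Rightarrow> ('b \<Rightarrow> 'k) \<Rightarrow> ('b \<Rightarrow> 'k) \<Rightarrow> 'b \<Rightarrow> 'k" where
  "mulH m x y = lext (\<lambda>a. lext (\<lambda>b. m a b) y) x"

definition mulT :: "('b \<Rightarrow> 'b \<Rightarrow> 'b \<Rightarrow> 'k::comm_ring_1) \<Rightarrow> ('b list \<Rightarrow> 'k) \<Rightarrow> ('b list \<Rightarrow> 'k) \<Rightarrow> 'b list \<Rightarrow> 'k" where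
  "mulT m x y = lext (\<lambda>v. lext (\<lambda>w. if length v = length w then tensl (map2 m v w) else 0) y) x"

definition idL :: "'b \<Rightarrow> 'b list \<Rightarrow> 'k::{zero,one}" where
  "idL a = bvec [a]"

definition epsL :: "('b \<Rightarrow> 'k::comm_ring_1) \<Rightarrow> 'b \<Rightarrow> 'b list \<Rightarrow> 'k" where
  "epsL e a = scal (e a) (bvec [])"

definition hopf_algebra ::
  "('b \<Rightarrow> 'b \<Rightarrow> 'b \<Rightarrow> 'k::field) \<Rightarrow> ('b \<Rightarrow> 'k) \<Rightarrow> ('b \<Rightarrow> 'b list \<Rightarrow> 'k) \<Rightarrow> ('b \<Rightarrow> 'k)
    \<Rightarrow> ('b \<Rightarrow> 'b \<Rightarrow> 'k) \<Rightarrow> bool" where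
  "hopf_algebra m u cm e S \<longleftrightarrow>
     (\<forall>a b. m a b \<in> fvec) \<and> u \<in> fvec \<and> (\<forall>a. cm a \<in> TP 2) \<and> (\<forall>a. S a \<in> fvec) \<and>
     (\<forall>x\<in>fvec. \<forall>y\<in>fvec. \<forall>z\<in>fvec. mulH m (mulH m x y) z = mulH m x (mulH m y z)) \<and>
     (\<forall>x\<in>fvec. mulH m u x = x \<and> mulH m x u = x) \<and>
     (\<forall>a. tmap [cm, idL] (cm a) = tmap [idL, cm] (cm a)) \<and>
     (\<forall>a. tmap [epsL e, idL] (cm a) = bvec [a] \<and> tmap [idL, epsL e] (cm a) = bvec [a]) \<and>
     (\<forall>x\<in>fvec. \<forall>y\<in>fvec. lext cm (mulH m x y) = mulT m (lext cm x) (lext cm y)) \<and>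
     lext cm u = tensl [u, u] \<and>
     (\<forall>x\<in>fvec. \<forall>y\<in>fvec. lfun e (mulH m x y) = lfun e x * lfun e y) \<and>
     lfun e u = 1 \<and>
     (\<forall>a. lext (\<lambda>w. if length w = 2 then mulH m (S (w!0)) (bvec (w!1)) else 0) (cm a)
            = scal (e a) u) \<and>
     (\<forall>a. lext (\<lambda>w. if length w = 2 then mulH m (bvec (w!0)) (S (w!1)) else 0) (cm a)
            = scal (e a) u)"

definition conj_field :: "('k::field_char_0 \<Rightarrow> 'k) \<Rightarrow> 'k \<Rightarrow> bool" where
  "conj_field cnj ii \<longleftrightarrow> ii * ii = -1 \<and> cnj ii = - ii \<and> cnj 1 = 1 \<and>
     (\<forall>x y. cnj (x + y) = cnj x + cnj y) \<and> (\<forall>x y. cnj (x * y) = cnj x * cnj y) \<and>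
     (\<forall>x. cnj (cnj x) = x)"

definition starV :: "('k \<Rightarrow> 'k) \<Rightarrow> ('b \<Rightarrow> 'b \<Rightarrow> 'k::comm_ring_1) \<Rightarrow> ('b \<Rightarrow> 'k) \<Rightarrow> 'b \<Rightarrow> 'k" where
  "starV cnj st = alext cnj st"

definition hopf_star_coalgebra ::
  "('k::field_char_0 \<Rightarrow> 'k) \<Rightarrow> ('b \<Rightarrow> 'b \<Rightarrow> 'b \<Rightarrow> 'k) \<Rightarrow> ('b \<Rightarrow> 'k) \<Rightarrow> ('b \<Rightarrow> 'b list \<Rightarrow> 'k)
    \<Rightarrow> ('b \<Rightarrow> 'k) \<Rightarrow> ('b \<Rightarrow> 'b \<Rightarrow> 'k) \<Rightarrow> ('b \<Rightarrow> 'b \<Rightarrow> 'k) \<Rightarrow> bool" where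
  "hopf_star_coalgebra cnj m u cm e S st \<longleftrightarrow>
     (\<forall>a. st a \<in> fvec) \<and>
     (\<forall>x\<in>fvec. starV cnj st (starV cnj st x) = x) \<and>
     (\<forall>x\<in>fvec. lext cm (starV cnj st x) =
        alext cnj (\<lambda>w. if length w = 2 then tensl [st (w!1), st (w!0)] else 0) (lext cm x)) \<and>
     (\<forall>x\<in>fvec. lfun e (starV cnj st x) = cnj (lfun e x)) \<and>
     (\<forall>x\<in>fvec. \<forall>y\<in>fvec. starV cnj st (mulH m x y) = mulH m (starV cnj st x) (starV cnj st y)) \<and>
     starV cnj st u = u \<and>
     (\<forall>x\<in>fvec. lext S (starV cnj st (lext S (starV cnj st x))) = x)"

definition modular_pair ::
  "('b \<Rightarrow> 'b \<Rightarrow> 'b \<Rightarrow> 'k::field) \<Rightarrow> ('b \<Rightarrow> 'k) \<Rightarrow> ('b \<Rightarrow> 'b list \<Rightarrow> 'k) \<Rightarrow> ('b \<Rightarrow> 'k)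
    \<Rightarrow> ('b \<Rightarrow> 'b \<Rightarrow> 'k) \<Rightarrow> ('b \<Rightarrow> 'k) \<Rightarrow> ('b \<Rightarrow> 'k) \<Rightarrow> bool" where
  "modular_pair m u cm e S sigma sinv \<longleftrightarrow>
     sigma \<in> fvec \<and> sinv \<in> fvec \<and>
     lext cm sigma = tensl [sigma, sigma] \<and> lfun e sigma = 1 \<and>
     mulH m sigma sinv = u \<and> mulH m sinv sigma = u \<and>
     (\<forall>x\<in>fvec. lext S (lext S x) = mulH m (mulH m sigma x) sinv)"

definition sigma_trace ::
  "('b \<Rightarrow> 'b \<Rightarrow> 'b \<Rightarrow> 'k::field) \<Rightarrow> ('b \<Rightarrow> 'b list \<Rightarrow> 'k) \<Rightarrow> ('b \<Rightarrow> 'k) \<Rightarrow> ('b \<Rightarrow> 'k) \<Rightarrow> bool" where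
  "sigma_trace m cm sigma Tr \<longleftrightarrow>
     (\<forall>a. lext (\<lambda>w. if length w = 2 then scal (Tr (w!0)) (bvec (w!1)) else 0) (cm a)
           = scal (Tr a) sigma) \<and>
     (\<forall>x\<in>fvec. \<forall>y\<in>fvec. lfun Tr (mulH m x y) = lfun Tr (mulH m y x))"

text \<open>A dihedral module is given by carriers C n, faces d n i (i = 0..n) of degree n,
  cyclic operators tau n and involutions om n. The cyclic complex is Connes' complex
  C n / Im(1 - t_n), t_n = (-1)^n tau_n, with differential b = sum (-1)^i d_i;
  the involution induced by omega on it is y_n = (-1)^(n(n+1)/2) omega_n.
  HC^s_n (s = +1 or -1) is the homology of the s-eigenspace of y on the cyclic complex;
  we describe it as the quotient dZ/dB of subsets of C n (preimages of the cycles and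
  boundaries of the eigen-subcomplex under C n -> C n / Im(1-t_n)).\<close>

definition bdry :: "(nat \<Rightarrow> nat \<Rightarrow> ('c \<Rightarrow> 'k::comm_ring_1) \<Rightarrow> 'c \<Rightarrow> 'k) \<Rightarrow> nat \<Rightarrow> ('c \<Rightarrow> 'k) \<Rightarrow> 'c \<Rightarrow> 'k" where
  "bdry d n x = (if n = 0 then 0 else (\<Sum>i\<le>n. scal ((-1)^i) (d n i x)))"

definition Iset :: "(nat \<Rightarrow> ('c \<Rightarrow> 'k::comm_ring_1) set) \<Rightarrow> (nat \<Rightarrow> ('c \<Rightarrow> 'k) \<Rightarrow> 'c \<Rightarrow> 'k) \<Rightarrow> nat \<Rightarrow> ('c \<Rightarrow> 'k) set" where
  "Iset C tau n = {x - scal ((-1)^n) (tau n x) | x. x \<in> C n}"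

definition yinv :: "(nat \<Rightarrow> ('c \<Rightarrow> 'k::comm_ring_1) \<Rightarrow> 'c \<Rightarrow> 'k) \<Rightarrow> nat \<Rightarrow> ('c \<Rightarrow> 'k) \<Rightarrow> 'c \<Rightarrow> 'k" where
  "yinv om n x = scal ((-1)^(n * (n + 1) div 2)) (om n x)"

definition dZ where
  "dZ C d tau om s n = {x \<in> C n. yinv om n x - scal s x \<in> Iset C tau n \<and> bdry d n x \<in> Iset C tau (n - 1)}"

definition dB where
  "dB C d tau om s n = {x \<in> C n. \<exists>w \<in> C (Suc n).
      yinv om (Suc n) w - scal s w \<in> Iset C tau (Suc n) \<and> x - bdry d (Suc n) w \<in> Iset C tau n}"

text \<open>k_0-linearity, k_0 the fixed field of conjugation (eigenspaces of an antilinear involution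
  are k_0-vector spaces)\<close>
definition k0lin :: "('k::comm_ring_1 \<Rightarrow> 'k) \<Rightarrow> ('c \<Rightarrow> 'k) set \<Rightarrow> (('c \<Rightarrow> 'k) \<Rightarrow> ('d \<Rightarrow> 'k)) \<Rightarrow> bool" where
  "k0lin cnj A f \<longleftrightarrow> (\<forall>x\<in>A. \<forall>y\<in>A. f (x + y) = f x + f y) \<and>
     (\<forall>c. \<forall>x\<in>A. cnj c = c \<longrightarrow> f (scal c x) = scal c (f x))"

text \<open>Z1/B1 is a direct summand of Z2/B2: k_0-linear maps i : Z1/B1 -> Z2/B2,
  p : Z2/B2 -> Z1/B1 (given on representatives) with p o i = id.\<close>
definition quot_direct_summand where
  "quot_direct_summand cnj Z1 B1 Z2 B2 \<longleftrightarrow> (\<exists>i p.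
      i ` Z1 \<subseteq> Z2 \<and> p ` Z2 \<subseteq> Z1 \<and> i ` B1 \<subseteq> B2 \<and> p ` B2 \<subseteq> B1 \<and>
      k0lin cnj Z1 i \<and> k0lin cnj Z2 p \<and> (\<forall>z\<in>Z1. p (i z) - z \<in> B1))"

definition CA :: "nat \<Rightarrow> ('b list \<Rightarrow> 'k::zero) set" where
  "CA n = TP (Suc n)"

definition faceA :: "('b \<Rightarrow> 'b \<Rightarrow> 'b \<Rightarrow> 'k::comm_ring_1) \<Rightarrow> nat \<Rightarrow> nat \<Rightarrow> ('b list \<Rightarrow> 'k) \<Rightarrow> 'b list \<Rightarrow> 'k" where
  "faceA m n i = lext (\<lambda>w. if i < n
      then tensl (map bvec (take i w) @ [m (w!i) (w!(Suc i))] @ map bvec (drop (i + 2) w))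
      else tensl (m (w!n) (w!0) # map bvec (take (n - 1) (drop 1 w))))"

definition tauA :: "nat \<Rightarrow> ('b list \<Rightarrow> 'k::comm_ring_1) \<Rightarrow> 'b list \<Rightarrow> 'k" where
  "tauA n = lext (\<lambda>w. bvec (last w # butlast w))"

definition omegaA :: "('k \<Rightarrow> 'k) \<Rightarrow> ('b \<Rightarrow> 'b \<Rightarrow> 'k::comm_ring_1) \<Rightarrow> ('b \<Rightarrow> 'b \<Rightarrow> 'k) \<Rightarrow> nat
    \<Rightarrow> ('b list \<Rightarrow> 'k) \<Rightarrow> 'b list \<Rightarrow> 'k" where
  "omegaA cnj S st n = alext cnj (\<lambda>w.
      tensl (map (\<lambda>a. starV cnj st (lext S (bvec a))) (hd w # rev (tl w))))"

definition CH :: "nat \<Rightarrow> ('b list \<Rightarrow> 'k::zero) set" where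
  "CH n = TP n"

definition faceH :: "('b \<Rightarrow> 'b \<Rightarrow> 'b \<Rightarrow> 'k::comm_ring_1) \<Rightarrow> ('b \<Rightarrow> 'k) \<Rightarrow> nat \<Rightarrow> nat
    \<Rightarrow> ('b list \<Rightarrow> 'k) \<Rightarrow> 'b list \<Rightarrow> 'k" where
  "faceH m e n i = lext (\<lambda>w. if i = 0 then scal (e (w!0)) (bvec (tl w))
      else if i < n then
        tensl (map bvec (take (i - 1) w) @ [m (w!(i - 1)) (w!i)] @ map bvec (drop (i + 1) w))
      else scal (e (last w)) (bvec (butlast w)))"

definition tauH :: "('b \<Rightarrow> 'b \<Rightarrow> 'b \<Rightarrow> 'k::comm_ring_1) \<Rightarrow> ('b \<Rightarrow> 'k) \<Rightarrow> ('b \<Rightarrow> 'b list \<Rightarrow> 'k)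
    \<Rightarrow> ('b \<Rightarrow> 'k) \<Rightarrow> ('b \<Rightarrow> 'b \<Rightarrow> 'k) \<Rightarrow> ('b \<Rightarrow> 'k) \<Rightarrow> nat \<Rightarrow> ('b list \<Rightarrow> 'k) \<Rightarrow> 'b list \<Rightarrow> 'k" where
  "tauH m u cm e S sigma n x = (if n = 0 then x else
     lext (\<lambda>v. if length v = 2 * n then
               (let ps = map (\<lambda>j. v!(2*j)) [0..<n]; qs = map (\<lambda>j. v!(2*j+1)) [0..<n] in
                scal (e (last qs))
                  (tensl (mulH m sigma (lext S (foldr (mulH m) (map bvec ps) u))
                          # map bvec (butlast qs))))
             else 0)
       (lext (\<lambda>w. foldr tprod (map cm w) (bvec [])) x))"

definition omegaH :: "('k \<Rightarrow> 'k) \<Rightarrow> ('b \<Rightarrow> 'b \<Rightarrow> 'k::comm_ring_1) \<Rightarrow> ('b \<Rightarrow> 'b \<Rightarrow> 'k) \<Rightarrow> nat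
    \<Rightarrow> ('b list \<Rightarrow> 'k) \<Rightarrow> 'b list \<Rightarrow> 'k" where
  "omegaH cnj S st n = alext cnj (\<lambda>w.
      tensl (map (\<lambda>a. the_inv_into fvec (lext S) (starV cnj st (bvec a))) (rev w)))"

end

theory Submission
  imports Defs "HOL-Library.Poly_Mapping"
begin

text \<open>
  Write \<open>P(h)\<close> for the product \<open>h\<^sup>1\<^sub>(\<^sub>1\<^sub>) \<cdots> h\<^sup>n\<^sub>(\<^sub>1\<^sub>)\<close> and \<open>h'\<close> for \<open>h\<^sup>1\<^sub>(\<^sub>2\<^sub>) \<otimes> \<cdots> \<otimes> h\<^sup>n\<^sub>(\<^sub>2\<^sub>)\<close>. The maps
  \<open>\<theta>(h) = \<sigma> S(P(h)) \<otimes> h'\<close> and \<open>\<gamma>(a \<otimes> h) = Tr(a P(h)) h'\<close> satisfy \<open>\<gamma> \<circ> \<theta> = Tr(\<sigma>)\<close>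
  by the antipode axiom, and commute with faces and cyclic operators. The map \<open>\<gamma>\<close> commutes with the
  involutions if \<open>Tr\<close> is real, meaning that \<open>Tr(S(h)\<^sup>*)\<close> is the conjugate of \<open>Tr(h)\<close>. This may be
  assumed: rescale to \<open>Tr(\<sigma>) = 1\<close> and average \<open>Tr\<close> with its conjugate under \<open>h \<mapsto> S(h)\<^sup>*\<close>.

  Compatibility of \<open>\<theta>\<close> with the last face needs \<open>S\<^sup>2(h) = \<sigma>\<^sup>-\<^sup>1 h \<sigma>\<close>, whereas the definition of a
  modular pair says \<open>S\<^sup>2(h) = \<sigma> h \<sigma>\<^sup>-\<^sup>1\<close>. The former holds because of the trace: \<open>\<gamma>\<close> in degree \<open>1\<close>
  is surjective and intertwines the flip of \<open>H \<otimes> H\<close> with \<open>h \<mapsto> \<sigma> S(h)\<close>, which is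
  therefore an involution.
\<close>

section \<open>The monad of finitely supported vectors\<close>

abbreviation coef :: "('a \<Rightarrow>\<^sub>0 'k::zero) \<Rightarrow> 'a \<Rightarrow> 'k" where
  "coef \<equiv> Poly_Mapping.lookup"

definition sc :: "'k::comm_ring_1 \<Rightarrow> ('a \<Rightarrow>\<^sub>0 'k) \<Rightarrow> 'a \<Rightarrow>\<^sub>0 'k" where
  "sc c X = Poly_Mapping.map ((*) c) X"

definition ret :: "'a \<Rightarrow> 'a \<Rightarrow>\<^sub>0 'k::comm_ring_1" where
  "ret a = Poly_Mapping.single a 1"

definition bind :: "('a \<Rightarrow>\<^sub>0 'k::comm_ring_1) \<Rightarrow> ('a \<Rightarrow> 'c \<Rightarrow>\<^sub>0 'k) \<Rightarrow> 'c \<Rightarrow>\<^sub>0 'k" where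
  "bind X F = (\<Sum>a\<in>Poly_Mapping.keys X. sc (coef X a) (F a))"

text \<open>Curried, so that Sweedler sums are rewritten with functions of two variables and without
  projections.\<close>

definition bind2 :: "('a \<times> 'b \<Rightarrow>\<^sub>0 'k::comm_ring_1) \<Rightarrow> ('a \<Rightarrow> 'b \<Rightarrow> 'c \<Rightarrow>\<^sub>0 'k) \<Rightarrow> 'c \<Rightarrow>\<^sub>0 'k" where
  "bind2 X F = bind X (\<lambda>z. F (fst z) (snd z))"

definition ev :: "('a \<Rightarrow> 'k::comm_ring_1) \<Rightarrow> ('a \<Rightarrow>\<^sub>0 'k) \<Rightarrow> 'k" where
  "ev f X = (\<Sum>a\<in>Poly_Mapping.keys X. coef X a * f a)"

lemma coef_sc [simp]: "coef (sc c X) a = c * coef X a"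
  by (cases "coef X a = 0") (auto simp: sc_def Poly_Mapping.map.rep_eq)

lemma coef_ret: "coef (ret a) b = (if a = b then 1 else 0)"
  by (simp add: ret_def lookup_single)

lemma sc_simps [simp]:
  "sc 1 X = X" "sc 0 X = 0" "sc c 0 = 0"
  by (auto intro!: poly_mapping_eqI)

lemma sc_sc: "sc c (sc d X) = sc (c * d) X"
  by (auto intro!: poly_mapping_eqI simp: mult.assoc)

lemma sc_add: "sc c (X + Y) = sc c X + sc c Y"
  by (auto intro!: poly_mapping_eqI simp: lookup_add algebra_simps)

lemma sc_add_scalar: "sc (c + d) X = sc c X + sc d X"
  by (auto intro!: poly_mapping_eqI simp: lookup_add algebra_simps)

lemma coef_bind: "coef (bind X F) c = (\<Sum>a\<in>Poly_Mapping.keys X. coef X a * coef (F a) c)"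
  by (simp add: bind_def lookup_sum)

text \<open>Supports change under addition and scaling, so sums over them are compared on a common
  finite set.\<close>

lemma sum_keys_superset:
  fixes X :: "'a \<Rightarrow>\<^sub>0 'k::comm_ring_1"
  assumes "finite A" "Poly_Mapping.keys X \<subseteq> A"
  shows "(\<Sum>a\<in>Poly_Mapping.keys X. coef X a * g a) = (\<Sum>a\<in>A. coef X a * g a)"
  using assms by (intro sum.mono_neutral_left) (auto simp: in_keys_iff)

lemma sum_keys_add:
  fixes X Y :: "'a \<Rightarrow>\<^sub>0 'k::comm_ring_1"
  shows "(\<Sum>a\<in>Poly_Mapping.keys (X + Y). coef (X + Y) a * g a) =
    (\<Sum>a\<in>Poly_Mapping.keys X. coef X a * g a) + (\<Sum>a\<in>Poly_Mapping.keys Y. coef Y a * g a)"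
proof -
  let ?A = "Poly_Mapping.keys X \<union> Poly_Mapping.keys Y"
  have "Poly_Mapping.keys (X + Y) \<subseteq> ?A" by (rule Poly_Mapping.keys_add)
  then show ?thesis
    by (subst (1 2 3) sum_keys_superset[where A = ?A])
      (auto simp: lookup_add algebra_simps sum.distrib)
qed

lemma sum_keys_sc:
  fixes X :: "'a \<Rightarrow>\<^sub>0 'k::comm_ring_1"
  shows "(\<Sum>a\<in>Poly_Mapping.keys (sc c X). coef (sc c X) a * g a) =
    c * (\<Sum>a\<in>Poly_Mapping.keys X. coef X a * g a)"
proof -
  have "Poly_Mapping.keys (sc c X) \<subseteq> Poly_Mapping.keys X" by (auto simp: in_keys_iff)
  then show ?thesis
    by (subst sum_keys_superset[where A = "Poly_Mapping.keys X"])
      (auto simp: algebra_simps sum_distrib_left)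
qed

lemma bind_add: "bind (X + Y) F = bind X F + bind Y F"
  by (rule poly_mapping_eqI) (simp only: coef_bind lookup_add[of "bind _ _"] sum_keys_add)

lemma bind_sc [simp]: "bind (sc c X) F = sc c (bind X F)"
  by (rule poly_mapping_eqI) (simp only: coef_bind sum_keys_sc coef_sc[of _ "bind _ _"])

lemma bind_0 [simp]: "bind 0 F = 0"
  by (simp add: bind_def)

lemma ret_bind [simp]: "bind (ret a) F = F a"
  by (rule poly_mapping_eqI) (simp add: coef_bind ret_def)

text \<open>A vector is the finite sum of its coefficients times basis vectors, so an identity
  linear in \<open>X\<close> need only be checked on \<open>ret a\<close>.\<close>

lemma vec_induct [case_names zero ret add sc]:
  fixes X :: "'a \<Rightarrow>\<^sub>0 'k::comm_ring_1"
  assumes "P 0" "\<And>a. P (ret a)" "\<And>X Y. P X \<Longrightarrow> P Y \<Longrightarrow> P (X + Y)" "\<And>c X. P X \<Longrightarrow> P (sc c X)"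
  shows "P X"
proof -
  have "X = (\<Sum>a\<in>Poly_Mapping.keys X. sc (coef X a) (ret a))"
    by (rule poly_mapping_eqI)
      (auto simp: lookup_sum coef_ret sum.delta if_distrib in_keys_iff cong: if_cong)
  moreover have "P (\<Sum>a\<in>A. sc (coef X a) (ret a))" if "finite A" for A
    using that by induction (auto intro: assms)
  ultimately show ?thesis by (metis finite_keys)
qed

lemma bind_ret [simp]: "bind X ret = X"
  by (induction X rule: vec_induct) (auto simp: bind_add)

lemma bind_assoc [simp]: "bind (bind X F) G = bind X (\<lambda>a. bind (F a) G)"
  by (induction X rule: vec_induct) (auto simp: bind_add)

lemma bind_fun_0 [simp]: "bind X (\<lambda>a. 0) = 0"
  by (induction X rule: vec_induct) (auto simp: bind_add)

lemma bind_fun_add: "bind X (\<lambda>a. F a + G a) = bind X F + bind X G"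
  by (induction X rule: vec_induct) (auto simp: bind_add sc_add)

lemma bind_fun_sc [simp]: "bind X (\<lambda>a. sc c (F a)) = sc c (bind X F)"
  by (induction X rule: vec_induct) (auto simp: bind_add sc_add sc_sc mult.commute)

text \<open>Interchange of finite sums. It is behind every reordering of independent Sweedler sums
  below.\<close>

lemma bind_commute: "bind X (\<lambda>a. bind Y (F a)) = bind Y (\<lambda>b. bind X (\<lambda>a. F a b))"
  by (induction X rule: vec_induct) (auto simp: bind_add bind_fun_add)

text \<open>For identities that hold only on words of the right length, which is a restriction on
  the support of \<open>X\<close>.\<close>

lemma bind_cong_keys:
  "(\<And>a. a \<in> Poly_Mapping.keys X \<Longrightarrow> F a = G a) \<Longrightarrow> bind X F = bind X G"
  by (simp add: bind_def cong: sum.cong)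

lemma ret_bind2 [simp]: "bind2 (ret (a, b)) F = F a b"
  by (simp add: bind2_def)

lemma bind2_bind [simp]: "bind2 (bind X F) G = bind X (\<lambda>a. bind2 (F a) G)"
  by (simp add: bind2_def)

lemma bind_bind2 [simp]: "bind (bind2 X F) G = bind2 X (\<lambda>a b. bind (F a b) G)"
  by (simp add: bind2_def)

lemma bind2_bind2 [simp]: "bind2 (bind2 X F) G = bind2 X (\<lambda>a b. bind2 (F a b) G)"
  by (simp add: bind2_def)

lemma bind2_ret: "bind2 X (\<lambda>a b. ret (a, b)) = X"
  by (simp add: bind2_def)

lemma bind2_fun_sc [simp]: "bind2 X (\<lambda>a b. sc c (F a b)) = sc c (bind2 X F)"
  by (simp add: bind2_def)

lemma bind2_commute:
  "bind2 X (\<lambda>a b. bind2 Y (F a b)) = bind2 Y (\<lambda>c d. bind2 X (\<lambda>a b. F a b c d))"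
  by (simp add: bind2_def bind_commute[of X])

lemma bind_bind2_commute: "bind X (\<lambda>a. bind2 Y (F a)) = bind2 Y (\<lambda>c d. bind X (\<lambda>a. F a c d))"
  by (simp add: bind2_def bind_commute[of X])

lemma ev_add: "ev f (X + Y) = ev f X + ev f Y"
  by (simp only: ev_def sum_keys_add)

lemma ev_sc [simp]: "ev f (sc c X) = c * ev f X"
  by (simp only: ev_def sum_keys_sc)

lemma ev_0 [simp]: "ev f 0 = 0"
  by (simp add: ev_def)

lemma ev_ret [simp]: "ev f (ret a) = f a"
  by (simp add: ev_def ret_def)

lemma bind_sc_fun: "bind X (\<lambda>a. sc (f a) Y) = sc (ev f X) Y"
  by (induction X rule: vec_induct) (auto simp: bind_add ev_add sc_add_scalar sc_sc)

text \<open>Linearity is expressed by the action on basis vectors, which avoids a quantifier over the index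
  types of \<open>bind\<close>.\<close>

definition lin :: "(('a \<Rightarrow>\<^sub>0 'k::comm_ring_1) \<Rightarrow> 'c \<Rightarrow>\<^sub>0 'k) \<Rightarrow> bool" where
  "lin L \<longleftrightarrow> (\<forall>X. L X = bind X (\<lambda>a. L (ret a)))"

named_theorems lin_intros

lemma linI: "(\<And>X. L X = bind X F) \<Longrightarrow> lin L"
  by (simp add: lin_def)

lemma linD: "lin L \<Longrightarrow> L X = bind X (\<lambda>a. L (ret a))"
  unfolding lin_def by (rule spec)

lemma lin_bind:
  assumes "lin L" shows "L (bind X F) = bind X (\<lambda>a. L (F a))"
proof -
  have "L (bind X F) = bind X (\<lambda>a. bind (F a) (\<lambda>b. L (ret b)))"
    unfolding bind_assoc[symmetric] by (rule linD[OF assms])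
  also have "\<dots> = bind X (\<lambda>a. L (F a))"
    by (rule arg_cong[of _ _ "bind X"], rule ext, rule linD[OF assms, symmetric])
  finally show ?thesis .
qed

lemma lin_bind2: "lin L \<Longrightarrow> L (bind2 X F) = bind2 X (\<lambda>a b. L (F a b))"
  by (simp add: bind2_def lin_bind)

lemma lin_sc:
  assumes "lin L" shows "L (sc c X) = sc c (L X)"
proof -
  have "L (sc c X) = sc c (bind X (\<lambda>a. L (ret a)))"
    unfolding bind_sc[symmetric] by (rule linD[OF assms])
  also have "bind X (\<lambda>a. L (ret a)) = L X" by (rule linD[OF assms, symmetric])
  finally show ?thesis .
qed

lemma lin_eqI:
  assumes "lin L" "lin L'" "\<And>a. L (ret a) = L' (ret a)"
  shows "L X = L' X"
proof -
  have "L X = bind X (\<lambda>a. L (ret a))" by (rule linD[OF assms(1)])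
  also have "\<dots> = bind X (\<lambda>a. L' (ret a))" by (simp only: assms(3))
  also have "\<dots> = L' X" by (rule linD[OF assms(2), symmetric])
  finally show ?thesis .
qed

lemma lin_id [lin_intros]: "lin (\<lambda>X. X)"
  by (rule linI[where F = ret]) simp

lemma lin_const_sc [lin_intros]:
  assumes "lin G" shows "lin (\<lambda>X. sc c (G X))"
  by (rule linI, rule trans[OF arg_cong[of _ _ "sc c", OF linD[OF assms]]], rule bind_fun_sc[symmetric])

lemma lin_bind_left [lin_intros]:
  assumes "lin G" shows "lin (\<lambda>X. bind (G X) F)"
  by (rule linI, rule trans[OF arg_cong[of _ _ "\<lambda>Y. bind Y F", OF linD[OF assms]]], rule bind_assoc)

lemma lin_bind_right [lin_intros]:
  assumes "\<And>a. lin (G a)" shows "lin (\<lambda>X. bind Y (\<lambda>a. G a X))"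
proof (rule linI)
  fix X
  have "bind Y (\<lambda>a. G a X) = bind Y (\<lambda>a. bind X (\<lambda>b. G a (ret b)))"
    by (rule arg_cong[of _ _ "bind Y"], rule ext, rule linD[OF assms])
  also have "\<dots> = bind X (\<lambda>b. bind Y (\<lambda>a. G a (ret b)))"
    by (rule bind_commute)
  finally show "bind Y (\<lambda>a. G a X) = bind X (\<lambda>b. bind Y (\<lambda>a. G a (ret b)))" .
qed

lemma lin_bind2_left [lin_intros]: "lin G \<Longrightarrow> lin (\<lambda>X. bind2 (G X) F)"
  by (simp add: bind2_def lin_intros)

lemma lin_bind2_right [lin_intros]:
  "(\<And>a b. lin (G a b)) \<Longrightarrow> lin (\<lambda>X. bind2 Y (\<lambda>a b. G a b X))"
  by (simp add: bind2_def lin_intros)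

text \<open>An evaluation used as a coefficient is rewritten as a \<open>bind\<close>, whose
  linearity is already known.\<close>

lemma lin_sc_ev [lin_intros]: "lin G \<Longrightarrow> lin (\<lambda>X. sc (ev f (G X)) Y)"
  by (simp add: lin_intros flip: bind_sc_fun)

lemma ev_bind: "ev f (bind X F) = ev (\<lambda>a. ev f (F a)) X"
  by (induction X rule: vec_induct) (auto simp: bind_add ev_add)

section \<open>Products, tensors and prefixing of letters as bilinear operations\<close>

definition mulV :: "('b \<Rightarrow> 'b \<Rightarrow> 'b \<Rightarrow>\<^sub>0 'k::comm_ring_1) \<Rightarrow> ('b \<Rightarrow>\<^sub>0 'k) \<Rightarrow> ('b \<Rightarrow>\<^sub>0 'k) \<Rightarrow> 'b \<Rightarrow>\<^sub>0 'k" where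
  "mulV M X Y = bind X (\<lambda>a. bind Y (\<lambda>b. M a b))"

definition tens :: "('a \<Rightarrow>\<^sub>0 'k::comm_ring_1) \<Rightarrow> ('b \<Rightarrow>\<^sub>0 'k) \<Rightarrow> 'a \<times> 'b \<Rightarrow>\<^sub>0 'k" where
  "tens X Y = bind X (\<lambda>a. bind Y (\<lambda>b. ret (a, b)))"

definition consV :: "('a \<Rightarrow>\<^sub>0 'k::comm_ring_1) \<Rightarrow> ('a list \<Rightarrow>\<^sub>0 'k) \<Rightarrow> 'a list \<Rightarrow>\<^sub>0 'k" where
  "consV X W = bind X (\<lambda>a. bind W (\<lambda>w. ret (a # w)))"

text \<open>Oriented so that rewriting absorbs sums into the bilinear operation; the rules for
  \<open>tens\<close> and \<open>consV\<close> have the same orientation. Where the defining sums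
  must be exposed, such rules are removed from the simpset.\<close>

lemma mulV_bind [simp]:
  "bind X (\<lambda>a. mulV M (F a) Y) = mulV M (bind X F) Y"
  "bind X (\<lambda>a. mulV M Y (F a)) = mulV M Y (bind X F)"
  by (simp_all add: mulV_def bind_commute[of X])

lemma mulV_sc [simp]: "mulV M (sc c X) Y = sc c (mulV M X Y)" "mulV M X (sc c Y) = sc c (mulV M X Y)"
  by (simp_all add: mulV_def)

lemma lin_mulV [lin_intros]:
  "lin G \<Longrightarrow> lin (\<lambda>X. mulV M (G X) Y)" "lin G \<Longrightarrow> lin (\<lambda>X. mulV M Y (G X))"
  by (simp_all add: mulV_def lin_intros)

lemma tens_bind [simp]:
  "bind X (\<lambda>a. tens (F a) Y) = tens (bind X F) Y"
  "bind X (\<lambda>a. tens Y (F a)) = tens Y (bind X F)"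
  "bind X (\<lambda>a. ret (a, b)) = tens X (ret b)"
  "bind Y (\<lambda>b. ret (a, b)) = tens (ret a) Y"
  by (simp_all add: tens_def bind_commute[of X])

lemma lin_tens [lin_intros]:
  "lin G \<Longrightarrow> lin (\<lambda>X. tens (G X) Y)" "lin G \<Longrightarrow> lin (\<lambda>X. tens Y (G X))"
  by (simp_all add: tens_def lin_intros del: tens_bind)

lemma bind2_tens [simp]: "bind2 (tens X Y) F = bind X (\<lambda>a. bind Y (F a))"
  by (simp add: tens_def del: tens_bind)

lemma consV_bind [simp]:
  "bind X (\<lambda>a. consV (F a) Z) = consV (bind X F) Z"
  "bind X (\<lambda>a. consV Y (G a)) = consV Y (bind X G)"
  "bind Y (\<lambda>a. ret (a # w)) = consV Y (ret w)"
  by (simp_all add: consV_def bind_commute[of X])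

lemma consV_sc [simp]: "consV (sc c X) Y = sc c (consV X Y)" "consV X (sc c Y) = sc c (consV X Y)"
  by (simp_all add: consV_def del: consV_bind)

lemma lin_consV [lin_intros]:
  "lin G \<Longrightarrow> lin (\<lambda>X. consV (G X) Y)" "lin H \<Longrightarrow> lin (\<lambda>X. consV Z (H X))"
  by (simp_all add: consV_def lin_intros del: consV_bind)

section \<open>Hopf algebras\<close>

text \<open>\<open>sw X F\<close> below is the Sweedler sum of \<open>F x\<^sub>(\<^sub>1\<^sub>) x\<^sub>(\<^sub>2\<^sub>)\<close>.\<close>

locale hopf =
  fixes M :: "'b \<Rightarrow> 'b \<Rightarrow> 'b \<Rightarrow>\<^sub>0 'k::field" and U :: "'b \<Rightarrow>\<^sub>0 'k" and D :: "'b \<Rightarrow> 'b \<times> 'b \<Rightarrow>\<^sub>0 'k"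
    and E :: "'b \<Rightarrow> 'k" and A :: "'b \<Rightarrow> 'b \<Rightarrow>\<^sub>0 'k"
  assumes mul_assoc: "mulV M (mulV M X Y) Z = mulV M X (mulV M Y Z)"
    and unit_mul [simp]: "mulV M U X = X"
    and mul_unit [simp]: "mulV M X U = X"
    and coassoc: "bind2 (D a) (\<lambda>x y. bind2 (D x) (\<lambda>p q. ret (p, q, y))) =
      bind2 (D a) (\<lambda>x y. bind2 (D y) (\<lambda>p q. ret (x, p, q)))"
    and counitL: "bind2 (D a) (\<lambda>x y. sc (E x) (ret y)) = ret a"
    and counitR: "bind2 (D a) (\<lambda>x y. sc (E y) (ret x)) = ret a"
    and D_mul: "bind (mulV M X Y) D =
      bind2 (bind X D) (\<lambda>x x'. bind2 (bind Y D) (\<lambda>y y'. tens (mulV M (ret x) (ret y)) (mulV M (ret x') (ret y'))))"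
    and D_unit: "bind U D = tens U U"
    and E_mul: "ev E (mulV M X Y) = ev E X * ev E Y"
    and E_unit: "ev E U = 1"
    and antipL: "bind2 (D a) (\<lambda>x y. mulV M (A x) (ret y)) = sc (E a) U"
    and antipR: "bind2 (D a) (\<lambda>x y. mulV M (ret x) (A y)) = sc (E a) U"
begin

abbreviation mul (infixl "\<star>" 70) where "X \<star> Y \<equiv> mulV M X Y"

definition S :: "('b \<Rightarrow>\<^sub>0 'k) \<Rightarrow> 'b \<Rightarrow>\<^sub>0 'k" where
  "S X = bind X A"

definition sw :: "('b \<Rightarrow>\<^sub>0 'k) \<Rightarrow> ('b \<Rightarrow> 'b \<Rightarrow> 'c \<Rightarrow>\<^sub>0 'k) \<Rightarrow> 'c \<Rightarrow>\<^sub>0 'k" where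
  "sw X F = bind2 (bind X D) F"

lemma S_bind [simp]: "bind X (\<lambda>a. S (F a)) = S (bind X F)"
  by (simp add: S_def)

lemma S_sc [simp]: "S (sc c X) = sc c (S X)"
  by (simp add: S_def)

lemma lin_S [lin_intros]: "lin G \<Longrightarrow> lin (\<lambda>X. S (G X))"
  by (simp add: S_def lin_intros)

lemma sw_bind [simp]: "sw (bind X F) G = bind X (\<lambda>a. sw (F a) G)"
  by (simp add: sw_def)

lemma bind_sw [simp]: "bind (sw X F) G = sw X (\<lambda>a b. bind (F a b) G)"
  by (simp add: sw_def)

lemma sw_fun_sc [simp]: "sw X (\<lambda>x y. sc c (F x y)) = sc c (sw X F)"
  by (simp add: sw_def)

lemma bind_ret_sw: "bind X (\<lambda>a. sw (ret a) F) = sw X F"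
  by (simp flip: sw_bind)

lemma lin_sw [lin_intros]:
  "lin G \<Longrightarrow> lin (\<lambda>X. sw (G X) F)" "(\<And>x y. lin (H x y)) \<Longrightarrow> lin (\<lambda>X. sw Y (\<lambda>x y. H x y X))"
  by (simp_all add: sw_def lin_intros)

lemma lin_sw_out: "lin L \<Longrightarrow> L (sw X F) = sw X (\<lambda>x y. L (F x y))"
  unfolding sw_def by (rule lin_bind2)

lemma sw_commute: "sw X (\<lambda>a b. sw Y (F a b)) = sw Y (\<lambda>c d. sw X (\<lambda>a b. F a b c d))"
  unfolding sw_def by (rule bind2_commute)

lemma bind_sw_commute: "bind X (\<lambda>a. sw Y (F a)) = sw Y (\<lambda>c d. bind X (\<lambda>a. F a c d))"
  unfolding sw_def by (rule bind_bind2_commute)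

text \<open>\<open>F\<close> is applied to the triples in \<open>coassoc\<close>, which is stated on
  basis vectors only.\<close>

lemma sw_coassoc:
  "sw X (\<lambda>x y. sw (ret x) (\<lambda>p q. F p q y)) = sw X (\<lambda>x y. sw (ret y) (\<lambda>p q. F x p q))"
proof -
  have "sw X (\<lambda>x y. sw (ret x) (\<lambda>p q. F p q y)) =
    bind X (\<lambda>a. bind2 (bind2 (D a) (\<lambda>x y. bind2 (D x) (\<lambda>p q. ret (p, q, y)))) (\<lambda>p z. F p (fst z) (snd z)))"
    by (simp add: sw_def)
  also have "\<dots> = sw X (\<lambda>x y. sw (ret y) (\<lambda>p q. F x p q))"
    by (subst coassoc) (simp add: sw_def)
  finally show ?thesis .
qed

lemma sw_counitL [simp]: "sw X (\<lambda>x y. sc (E x) (F y)) = bind X F"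
proof -
  have "sw X (\<lambda>x y. sc (E x) (F y)) = bind X (\<lambda>a. bind (bind2 (D a) (\<lambda>x y. sc (E x) (ret y))) F)"
    by (simp add: sw_def)
  then show ?thesis by (simp add: counitL)
qed

lemma sw_counitR [simp]: "sw X (\<lambda>x y. sc (E y) (F x)) = bind X F"
proof -
  have "sw X (\<lambda>x y. sc (E y) (F x)) = bind X (\<lambda>a. bind (bind2 (D a) (\<lambda>x y. sc (E y) (ret x))) F)"
    by (simp add: sw_def)
  then show ?thesis by (simp add: counitR)
qed

lemma sw_mul: "sw (X \<star> Y) F =
  sw X (\<lambda>x x'. sw Y (\<lambda>y y'. bind (ret x \<star> ret y) (\<lambda>p. bind (ret x' \<star> ret y') (\<lambda>q. F p q))))"
  by (simp add: sw_def D_mul)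

lemma sw_unit: "sw U F = bind U (\<lambda>p. bind U (\<lambda>q. F p q))"
  by (simp add: sw_def D_unit)

text \<open>\<open>L\<close> stands for the surrounding expression: the antipode axiom becomes
  usable deep inside a product, a trace or a tensor.\<close>

lemma sw_antipL: 
  assumes "lin L" shows "sw X (\<lambda>x y. L (S (ret x) \<star> ret y)) = sc (ev E X) (L U)"
proof -
  have "sw X (\<lambda>x y. S (ret x) \<star> ret y) = sc (ev E X) U"
    by (simp add: sw_def S_def antipL bind_sc_fun)
  then show ?thesis using lin_sw_out[OF assms, of X "\<lambda>x y. S (ret x) \<star> ret y"] lin_sc[OF assms] by simp
qed

lemma sw_antipR: 
  assumes "lin L" shows "sw X (\<lambda>x y. L (ret x \<star> S (ret y))) = sc (ev E X) (L U)"
proof -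
  have "sw X (\<lambda>x y. ret x \<star> S (ret y)) = sc (ev E X) U"
    by (simp add: sw_def S_def antipR bind_sc_fun)
  then show ?thesis using lin_sw_out[OF assms, of X "\<lambda>x y. ret x \<star> S (ret y)"] lin_sc[OF assms] by simp
qed

text \<open>Both sides are convolution inverses of the multiplication.\<close>

lemma S_mul: "S (X \<star> Y) = S Y \<star> S X"
proof -
  \<comment> \<open>\<open>?K\<close> is the threefold convolution of
    \<open>S (a \<star> b)\<close>, \<open>a \<star> b\<close> and \<open>S b \<star> S a\<close>.
    Facts \<open>1\<close> and \<open>2\<close> cancel the last two factors, \<open>3\<close> and
    \<open>4\<close> the first two.\<close>
  let ?G = "\<lambda>a1 b1 a2 b2 a3 b3.
    S (ret a1 \<star> ret b1) \<star> (ret a2 \<star> (ret b2 \<star> (S (ret b3) \<star> S (ret a3))))"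
  let ?K = "sw X (\<lambda>a1 a. sw Y (\<lambda>b1 b. sw (ret a) (\<lambda>a2 a3. sw (ret b) (\<lambda>b2 b3. ?G a1 b1 a2 b2 a3 b3))))"
  have 1: "sw (ret b) (\<lambda>b2 b3. ?G a1 b1 a2 b2 a3 b3) =
      sc (E b) (S (ret a1 \<star> ret b1) \<star> (ret a2 \<star> S (ret a3)))" for a1 b1 a2 a3 b
    using sw_antipR[of "\<lambda>Z. S (ret a1 \<star> ret b1) \<star> (ret a2 \<star> (Z \<star> S (ret a3)))" "ret b"]
    by (simp add: lin_intros mul_assoc)
  have 2: "sw (ret a) (\<lambda>a2 a3. S (ret a1 \<star> ret b1) \<star> (ret a2 \<star> S (ret a3))) =
      sc (E a) (S (ret a1 \<star> ret b1))" for a a1 b1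
    using sw_antipR[of "\<lambda>Z. S (ret a1 \<star> ret b1) \<star> Z" "ret a"] by (simp add: lin_intros)
  have K1: "?K = S (X \<star> Y)" by (simp add: 1 2)
  have 3: "sw (ret a) (\<lambda>a1 a2. sw (ret b) (\<lambda>b1 b2. S (ret a1 \<star> ret b1) \<star> (ret a2 \<star> ret b2))) =
      sc (E a) (sc (E b) U)" for a b
    using sw_antipL[of "\<lambda>Z. Z" "ret a \<star> ret b"] by (simp add: lin_intros sw_mul E_mul sc_sc)
  have 4: "sw (ret a) (\<lambda>a1 a2. sw (ret b) (\<lambda>b1 b2. ?G a1 b1 a2 b2 a3 b3)) =
      sc (E a) (sc (E b) (S (ret b3) \<star> S (ret a3)))" for a b a3 b3
    using arg_cong[OF 3[of a b], of "\<lambda>Z. Z \<star> (S (ret b3) \<star> S (ret a3))"]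
      lin_sw_out[of "\<lambda>Z. Z \<star> (S (ret b3) \<star> S (ret a3))"]
    by (simp add: lin_intros mul_assoc)
  \<comment> \<open>Commuting the interleaved sums puts the two splittings of \<open>X\<close> next
    to each other, where coassociativity applies.\<close>
  have "?K = sw X (\<lambda>a1 a. sw (ret a) (\<lambda>a2 a3. sw Y (\<lambda>b1 b. sw (ret b) (\<lambda>b2 b3. ?G a1 b1 a2 b2 a3 b3))))"
    by (simp only: sw_commute[of Y])
  also have "\<dots> = sw X (\<lambda>a a3. sw (ret a) (\<lambda>a1 a2. sw Y (\<lambda>b b3. sw (ret b) (\<lambda>b1 b2. ?G a1 b1 a2 b2 a3 b3))))"
    by (simp only: sw_coassoc[symmetric])
  also have "\<dots> = sw X (\<lambda>a a3. sw Y (\<lambda>b b3. sw (ret a) (\<lambda>a1 a2. sw (ret b) (\<lambda>b1 b2. ?G a1 b1 a2 b2 a3 b3))))"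
    by (simp only: sw_commute[of Y])
  also have "\<dots> = S Y \<star> S X" by (simp only: 4) simp
  finally show ?thesis using K1 by simp
qed

section \<open>The tensor square as an algebra, and the coproduct of the antipode\<close>

definition mul2 :: "('b \<times> 'b \<Rightarrow>\<^sub>0 'k) \<Rightarrow> ('b \<times> 'b \<Rightarrow>\<^sub>0 'k) \<Rightarrow> 'b \<times> 'b \<Rightarrow>\<^sub>0 'k" where
  "mul2 P Q = bind2 P (\<lambda>p p'. bind2 Q (\<lambda>q q'. tens (ret p \<star> ret q) (ret p' \<star> ret q')))"

lemma lin_mul2 [lin_intros]:
  "lin G \<Longrightarrow> lin (\<lambda>X. mul2 (G X) Y)" "lin G \<Longrightarrow> lin (\<lambda>X. mul2 Y (G X))"
  by (simp_all add: mul2_def lin_intros)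

lemma mul2_tens: "mul2 (tens P P') (tens Q Q') = tens (P \<star> Q) (P' \<star> Q')"
  by (simp add: mul2_def)

lemma tens_ret: "tens (ret a) (ret b) = ret (a, b)"
  by (simp add: tens_def del: tens_bind)

text \<open>Linearity reduces one argument after the other to basis vectors; on pure tensors the
  claim is \<open>mul_assoc\<close> in each component.\<close>

lemma mul2_assoc: "mul2 (mul2 P Q) R = mul2 P (mul2 Q R)"
proof -
  have 1: "mul2 (mul2 (ret p) (ret q)) (ret r) = mul2 (ret p) (mul2 (ret q) (ret r))" for p q r
    by (cases p; cases q; cases r) (simp add: mul2_tens mul_assoc flip: tens_ret)
  have 2: "mul2 (mul2 (ret p) (ret q)) R = mul2 (ret p) (mul2 (ret q) R)" for p q
    by (rule lin_eqI) (auto intro!: lin_intros simp: 1)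
  have 3: "mul2 (mul2 (ret p) Q) R = mul2 (ret p) (mul2 Q R)" for p
    by (rule lin_eqI[where X = Q]) (auto intro!: lin_intros simp: 2)
  show ?thesis
    by (rule lin_eqI[where X = P]) (auto intro!: lin_intros simp: 3)
qed

lemma mul2_unit: "mul2 (tens U U) P = P" "mul2 P (tens U U) = P"
proof -
  have *: "mul2 (tens U U) (ret p) = ret p" "mul2 (ret p) (tens U U) = ret p" for p
    by (cases p, simp add: mul2_tens flip: tens_ret)+
  show "mul2 (tens U U) P = P" "mul2 P (tens U U) = P"
    by (rule lin_eqI[where X = P], auto intro!: lin_intros simp: *)+
qed

lemma D_mul2: "bind (X \<star> Y) D = mul2 (bind X D) (bind Y D)"
  by (simp add: mul2_def D_mul)

text \<open>Both sides are convolution inverses of the comultiplication.\<close>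

lemma S_comul: "bind (S X) D = sw X (\<lambda>x y. tens (S (ret y)) (S (ret x)))"
proof -
  \<comment> \<open>\<open>T\<close> is \<open>S \<otimes> S\<close> after the flipped coproduct,
    and \<open>?K\<close> the threefold convolution of \<open>D\<close> after \<open>S\<close>, of
    \<open>D\<close>, and of \<open>T\<close>.\<close>
  define T where "T = (\<lambda>X. sw X (\<lambda>x y. tens (S (ret y)) (S (ret x))))"
  have lin_T [lin_intros]: "lin G \<Longrightarrow> lin (\<lambda>X. T (G X))" for G :: "('b \<Rightarrow>\<^sub>0 'k) \<Rightarrow> 'b \<Rightarrow>\<^sub>0 'k"
    by (simp add: T_def lin_intros)
  let ?K = "sw X (\<lambda>x t. sw (ret t) (\<lambda>y z. mul2 (mul2 (bind (S (ret x)) D) (D y)) (T (ret z))))"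
  \<comment> \<open>The sum is
    \<open>x\<^sub>1 S(x\<^sub>4) \<otimes> x\<^sub>2 S(x\<^sub>3)\<close>; coassociativity lets the
    inner pair cancel before the outer one.\<close>
  have inv: "sw X (\<lambda>x y. mul2 (D x) (T (ret y))) = sc (ev E X) (tens U U)" for X
  proof -
    have 1: "sw (ret s) (\<lambda>y z. tens (ret x \<star> S (ret w)) (ret y \<star> S (ret z))) =
        sc (E s) (tens (ret x \<star> S (ret w)) U)" for s x w
      using sw_antipR[of "\<lambda>Z. tens (ret x \<star> S (ret w)) Z" "ret s"] by (simp add: lin_intros)
    have 2: "mul2 (D x) (T (ret y)) =
        sw (ret x) (\<lambda>p q. sw (ret y) (\<lambda>z w. tens (ret p \<star> S (ret w)) (ret q \<star> S (ret z))))" for x y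
    proof -
      have "mul2 (D x) (T (ret y)) =
        sw (ret x) (\<lambda>p q. sw (ret y) (\<lambda>z w. mul2 (ret (p, q)) (tens (S (ret w)) (S (ret z)))))"
        by (subst bind2_ret[symmetric, of "D x"]) (simp add: T_def sw_def mul2_def)
      then show ?thesis by (simp add: mul2_tens flip: tens_ret)
    qed
    have "sw X (\<lambda>x y. mul2 (D x) (T (ret y))) =
        sw X (\<lambda>x t. sw (ret t) (\<lambda>q y. sw (ret y) (\<lambda>z w. tens (ret x \<star> S (ret w)) (ret q \<star> S (ret z)))))"
      by (simp only: 2 sw_coassoc)
    also have "\<dots> = sw X (\<lambda>x t. sw (ret t) (\<lambda>s w. sw (ret s) (\<lambda>y z. tens (ret x \<star> S (ret w)) (ret y \<star> S (ret z)))))"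
      by (simp only: sw_coassoc)
    also have "\<dots> = sw X (\<lambda>x t. tens (ret x \<star> S (ret t)) U)"
      by (simp add: 1)
    also have "\<dots> = sc (ev E X) (tens U U)"
      by (rule sw_antipR) (intro lin_intros)
    finally show ?thesis .
  qed
  have "?K = sw X (\<lambda>x t. sc (E t) (bind (S (ret x)) D))"
  proof -
    have "sw (ret t) (\<lambda>y z. mul2 (mul2 P (D y)) (T (ret z))) = sc (E t) P" for t P
      using inv[of "ret t"] lin_sw_out[of "mul2 P" "ret t" "\<lambda>x y. mul2 (D x) (T (ret y))"]
        lin_sc[of "mul2 P"] lin_mul2(2)[OF lin_id]
      by (simp add: mul2_assoc mul2_unit)
    then show ?thesis by simp
  qed
  also have "\<dots> = bind (S X) D" by (simp add: S_def)
  finally have "bind (S X) D = ?K" by simp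
  \<comment> \<open>Multiplicativity of \<open>D\<close> merges the first two factors into the
    coproduct of \<open>S x \<star> y\<close>, which the antipode axiom reduces to the unit.\<close>
  also have "\<dots> = sw X (\<lambda>t z. sw (ret t) (\<lambda>x y. mul2 (bind (S (ret x) \<star> ret y) D) (T (ret z))))"
    by (simp only: sw_coassoc D_mul2 ret_bind)
  also have "\<dots> = sw X (\<lambda>t z. sc (E t) (T (ret z)))"
    by (simp add: sw_antipL[of "\<lambda>Z. mul2 (bind Z D) Y" for Y] lin_intros D_unit mul2_unit)
  also have "\<dots> = T X" by (simp add: T_def bind_ret_sw)
  finally show ?thesis by (simp add: T_def)
qed

lemma sw_S: "sw (S X) F = sw X (\<lambda>x y. bind (S (ret y)) (\<lambda>p. bind (S (ret x)) (\<lambda>q. F p q)))"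
  by (simp add: sw_def[of "S X"] S_comul) (simp add: sw_def)

lemma S_unit: "S U = U"
  using sw_antipL[of "\<lambda>Z. Z" U] by (simp add: lin_intros sw_unit E_unit)

end

section \<open>The diagonal coaction and the comparison maps\<close>

lemma bind_sc_ev [simp]: "bind X (\<lambda>a. sc (ev f (F a)) Y) = sc (ev f (bind X F)) Y"
  by (simp add: ev_bind bind_sc_fun)

lemma bind_bind_mulV [simp]:
  "bind X (\<lambda>a. bind (mulV M (F a) Y) G) = bind (mulV M (bind X F) Y) G"
  "bind X (\<lambda>a. bind (mulV M Y (F a)) G) = bind (mulV M Y (bind X F)) G"
  by (simp_all flip: mulV_bind)

lemma bind_consV: "bind (consV X W) F = bind X (\<lambda>a. bind W (\<lambda>w. F (a # w)))"
  by (simp add: consV_def del: consV_bind)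

lemma sc_commute: "sc c (sc d X) = sc d (sc c X)"
  by (simp add: sc_sc mult.commute)

section \<open>Faces and cyclic operators on basis words\<close>

definition merge :: "('b \<Rightarrow> 'b \<Rightarrow> 'b \<Rightarrow>\<^sub>0 'k::comm_ring_1) \<Rightarrow> nat \<Rightarrow> 'b list \<Rightarrow> 'b list \<Rightarrow>\<^sub>0 'k" where
  "merge M i w = bind (M (w ! i) (w ! Suc i)) (\<lambda>c. ret (take i w @ c # drop (i + 2) w))"

lemma mulV_ret: "mulV M (ret a) (ret b) = M a b"
  by (simp add: mulV_def)

lemma merge_0: "merge M 0 (a # b # w) = consV (mulV M (ret a) (ret b)) (ret w)"
  by (simp add: merge_def mulV_ret)

lemma merge_Suc: "merge M (Suc i) (a # w) = consV (ret a) (merge M i w)"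
  by (simp add: merge_def bind_consV consV_def[of "ret a"] del: consV_bind)

text \<open>The inner face \<open>i\<close> merges positions \<open>i\<close> and
  \<open>i + 1\<close> here, but \<open>i - 1\<close> and \<open>i\<close> in \<open>faceH'\<close>:
  words on the Hopf side lack the letter in position 0.\<close>

definition faceA' :: "('b \<Rightarrow> 'b \<Rightarrow> 'b \<Rightarrow>\<^sub>0 'k::comm_ring_1) \<Rightarrow> nat \<Rightarrow> nat \<Rightarrow> 'b list \<Rightarrow> 'b list \<Rightarrow>\<^sub>0 'k" where
  "faceA' M n i w = (if i < n then merge M i w
     else consV (mulV M (ret (w ! n)) (ret (w ! 0))) (ret (take (n - 1) (drop 1 w))))"

definition faceH' :: "('b \<Rightarrow> 'b \<Rightarrow> 'b \<Rightarrow>\<^sub>0 'k::comm_ring_1) \<Rightarrow> ('b \<Rightarrow> 'k) \<Rightarrow> nat \<Rightarrow> nat \<Rightarrow> 'b list \<Rightarrow> 'b list \<Rightarrow>\<^sub>0 'k" where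
  "faceH' M E n i w = (if i = 0 then sc (E (w ! 0)) (ret (tl w))
     else if i < n then merge M (i - 1) w else sc (E (last w)) (ret (butlast w)))"

definition tauA' :: "'b list \<Rightarrow> 'b list \<Rightarrow>\<^sub>0 'k::comm_ring_1" where
  "tauA' w = ret (last w # butlast w)"

section \<open>The diagonal coaction and its comodule axioms\<close>

context hopf
begin

text \<open>The left comodule structure of the Hopf algebra on its tensor powers; on the ground
  field, spanned by the empty word, it is the trivial coaction.\<close>

primrec coaction :: "'b list \<Rightarrow> 'b \<times> 'b list \<Rightarrow>\<^sub>0 'k" where
  "coaction [] = tens U (ret [])"
| "coaction (a # w) = sw (ret a) (\<lambda>x y. bind2 (coaction w) (\<lambda>p v. tens (ret x \<star> ret p) (ret (y # v))))"

text \<open>\<open>coact W F\<close> is the sum of \<open>F (h\<^sup>1\<^sub>(\<^sub>1\<^sub>) \<cdots> h\<^sup>n\<^sub>(\<^sub>1\<^sub>)) (h\<^sup>1\<^sub>(\<^sub>2\<^sub>) \<otimes> \<cdots> \<otimes> h\<^sup>n\<^sub>(\<^sub>2\<^sub>))\<close> over the words of \<open>W\<close>.\<close>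

definition coact :: "('b list \<Rightarrow>\<^sub>0 'k) \<Rightarrow> ('b \<Rightarrow> 'b list \<Rightarrow> 'c \<Rightarrow>\<^sub>0 'k) \<Rightarrow> 'c \<Rightarrow>\<^sub>0 'k" where
  "coact W F = bind2 (bind W coaction) F"

lemma coact_Nil [simp]: "coact (ret []) F = bind U (\<lambda>p. F p [])"
  by (simp add: coact_def)

lemma coact_Cons: "coact (ret (a # w)) F =
    sw (ret a) (\<lambda>x y. coact (ret w) (\<lambda>p v. bind (ret x \<star> ret p) (\<lambda>q. F q (y # v))))"
  by (simp add: coact_def sw_def)

lemma coact_bind [simp]: "coact (bind W F) G = bind W (\<lambda>w. coact (F w) G)"
  by (simp add: coact_def)

lemma bind_coact [simp]: "bind (coact W F) G = coact W (\<lambda>p v. bind (F p v) G)"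
  by (simp add: coact_def)

lemma coact_coact [simp]: "coact (coact W F) G = coact W (\<lambda>p v. coact (F p v) G)"
  by (simp add: coact_def)

lemma coact_fun_sc [simp]: "coact W (\<lambda>p v. sc c (F p v)) = sc c (coact W F)"
  by (simp add: coact_def)

lemma bind_ret_coact: "bind W (\<lambda>w. coact (ret w) F) = coact W F"
  by (simp flip: coact_bind)

lemma coact_sw_commute: "coact W (\<lambda>p v. sw X (F p v)) = sw X (\<lambda>x y. coact W (\<lambda>p v. F p v x y))"
  unfolding coact_def sw_def by (rule bind2_commute)

lemma bind_coact_commute: "bind X (\<lambda>a. coact W (F a)) = coact W (\<lambda>p v. bind X (\<lambda>a. F a p v))"
  unfolding coact_def by (rule bind_bind2_commute)

text \<open>The coaction preserves word length, which matters where a face reads off a letter at a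
  numbered position.\<close>

lemma coact_cong:
  "(\<And>p v. length v = length w \<Longrightarrow> F p v = G p v) \<Longrightarrow> coact (ret w) F = coact (ret w) G"
proof (induction w arbitrary: F G)
  case (Cons a w)
  have "coact (ret w) (\<lambda>p v. bind (ret x \<star> ret p) (\<lambda>q. F q (y # v))) =
      coact (ret w) (\<lambda>p v. bind (ret x \<star> ret p) (\<lambda>q. G q (y # v)))" for x y
    by (rule Cons.IH) (simp add: Cons.prems)
  then show ?case by (simp only: coact_Cons)
qed simp

lemma coact_consV: "coact (consV X W) F = sw X (\<lambda>x y. coact W (\<lambda>p v. bind (ret x \<star> ret p) (\<lambda>q. F q (y # v))))"
  by (simp add: consV_def coact_Cons del: consV_bind)
    (simp add: bind_sw_commute bind_ret_coact bind_ret_sw)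

lemma coact_append: "coact (ret (w @ w')) F =
    coact (ret w) (\<lambda>p v. coact (ret w') (\<lambda>q v'. bind (ret p \<star> ret q) (\<lambda>r. F r (v @ v'))))"
proof (induction w arbitrary: F)
  case Nil
  then show ?case by (simp add: bind_coact_commute)
next
  case (Cons a w)
  then show ?case by (simp add: coact_Cons bind_coact_commute mul_assoc)
qed

text \<open>Last faces and cyclic operators act on the last letter, whereas \<open>coaction\<close>
  recurses on the first.\<close>

lemma coact_snoc: "coact (ret (w @ [b])) F =
    coact (ret w) (\<lambda>p v. sw (ret b) (\<lambda>x y. bind (ret p \<star> ret x) (\<lambda>r. F r (v @ [y]))))"
  by (simp add: coact_append coact_Cons)

text \<open>Coassociativity of the coaction, by induction on the word: the step combines
  coassociativity for the first letter with multiplicativity of the coproduct.\<close>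

lemma coact_coassoc:
  "coact W (\<lambda>p v. coact (ret v) (\<lambda>q v'. F p q v')) = coact W (\<lambda>r v. sw (ret r) (\<lambda>p q. F p q v))"
proof -
  have "coact (ret w) (\<lambda>p v. coact (ret v) (\<lambda>q v'. F p q v')) = coact (ret w) (\<lambda>r v. sw (ret r) (\<lambda>p q. F p q v))" for w
  proof (induction w arbitrary: F)
    case Nil
    then show ?case by (simp add: sw_unit bind_ret_sw)
  next
    case (Cons a w)
    let ?G = "\<lambda>x y1 p p' y2 v. bind (ret x \<star> ret p) (\<lambda>q. bind (ret y1 \<star> ret p') (\<lambda>q'. F q q' (y2 # v)))"
    have "coact (ret (a # w)) (\<lambda>p v. coact (ret v) (\<lambda>q v'. F p q v')) =
        sw (ret a) (\<lambda>x y. sw (ret y) (\<lambda>y1 y2. coact (ret w) (\<lambda>p v. coact (ret v) (\<lambda>p' v'. ?G x y1 p p' y2 v'))))"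
      by (simp add: coact_Cons bind_sw_commute bind_coact_commute coact_sw_commute)
    also have "\<dots> = sw (ret a) (\<lambda>x y. sw (ret y) (\<lambda>y1 y2. coact (ret w) (\<lambda>r v. sw (ret r) (\<lambda>p p'. ?G x y1 p p' y2 v))))"
      by (simp only: Cons.IH)
    also have "\<dots> = sw (ret a) (\<lambda>y y2. sw (ret y) (\<lambda>x y1. coact (ret w) (\<lambda>r v. sw (ret r) (\<lambda>p p'. ?G x y1 p p' y2 v))))"
      by (simp only: sw_coassoc)
    also have "\<dots> = coact (ret (a # w)) (\<lambda>r v. sw (ret r) (\<lambda>p q. F p q v))"
      by (simp add: coact_Cons bind_ret_sw sw_mul coact_sw_commute)
    finally show ?case .
  qed
  then show ?thesis by (simp flip: bind_ret_coact[of W])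
qed

text \<open>The counit axiom of the coaction, which rests on the counit being
  multiplicative.\<close>

lemma coact_counit [simp]: "coact W (\<lambda>p v. sc (E p) (F v)) = bind W F"
proof -
  have "coact (ret w) (\<lambda>p v. sc (E p) (F v)) = F w" for w
  proof (induction w arbitrary: F)
    case Nil
    then show ?case by (simp add: bind_sc_fun E_unit)
  next
    case (Cons a w)
    have "coact (ret (a # w)) (\<lambda>p v. sc (E p) (F v)) =
        sw (ret a) (\<lambda>x y. coact (ret w) (\<lambda>p v. sc (E x) (sc (E p) (F (y # v)))))"
      by (simp add: coact_Cons bind_sc_fun E_mul sc_sc)
    also have "\<dots> = F (a # w)"
      by (simp add: Cons)
    finally show ?case .
  qed
  then show ?thesis by (simp flip: bind_ret_coact[of W])
qed

text \<open>Multiplying neighbours is a comodule map because the coproduct is multiplicative; the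
  product of all first legs changes only by its bracketing.\<close>

lemma coact_merge:
  "Suc i < length w \<Longrightarrow> coact (merge M i w) F = coact (ret w) (\<lambda>p v. bind (merge M i v) (F p))"
proof (induction i arbitrary: w F)
  case 0
  then obtain a b y where w: "w = a # b # y"
    by (cases w; cases "tl w") auto
  have inner: "bind P (\<lambda>s. bind Q (\<lambda>t. coact W (\<lambda>p v. bind (ret s \<star> ret p) (\<lambda>q. F q (t # v))))) =
      coact W (\<lambda>p v. bind (P \<star> ret p) (\<lambda>q. bind Q (\<lambda>t. F q (t # v))))" for P Q W
    by (simp add: bind_coact_commute bind_commute[of Q])
  show ?case
    by (simp add: w coact_consV merge_0 coact_Cons sw_mul inner)
      (simp add: bind_consV bind_coact_commute bind_sw_commute mul_assoc)
next
  case (Suc i)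
  then obtain a y where w: "w = a # y" and "Suc i < length y" by (cases w) auto
  then show ?case
    by (simp add: w merge_Suc coact_consV coact_Cons Suc.IH bind_consV bind_commute[of "merge _ _ _"]
        bind_coact_commute)
qed

section \<open>The comparison maps and their compatibility with faces and cyclic operators\<close>

definition theta :: "('b \<Rightarrow>\<^sub>0 'k) \<Rightarrow> 'b list \<Rightarrow> 'b list \<Rightarrow>\<^sub>0 'k" where
  "theta g w = coact (ret w) (\<lambda>p v. consV (g \<star> S (ret p)) (ret v))"

definition gamma :: "('b \<Rightarrow> 'k) \<Rightarrow> 'b list \<Rightarrow> 'b list \<Rightarrow>\<^sub>0 'k" where
  "gamma T w = coact (ret (tl w)) (\<lambda>p v. sc (ev T (ret (hd w) \<star> ret p)) (ret v))"

text \<open>In degree 0 the cyclic operator is the identity, and \<open>last\<close> has no meaning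
  on the empty word; hence the case split.\<close>

definition tauH' :: "('b \<Rightarrow>\<^sub>0 'k) \<Rightarrow> 'b list \<Rightarrow> 'b list \<Rightarrow>\<^sub>0 'k" where
  "tauH' g w = (if w = [] then ret []
     else coact (ret w) (\<lambda>p v. sc (E (last v)) (consV (g \<star> S (ret p)) (ret (butlast v)))))"

lemma bind_consV_gamma: "bind (consV X W) (gamma T) = coact W (\<lambda>p v. sc (ev T (X \<star> ret p)) (ret v))"
  by (simp add: bind_consV gamma_def bind_ret_coact bind_coact_commute)

lemma bind_theta: "bind W (theta g) = coact W (\<lambda>p v. consV (g \<star> S (ret p)) (ret v))"
  unfolding theta_def by (rule bind_ret_coact)

text \<open>The counit removes the second leg of the last letter, so this letter enters the antipode
  unsplit.\<close>

lemma tauH'_snoc: "tauH' g (w @ [b]) = coact (ret w) (\<lambda>p v. consV (g \<star> S (ret p \<star> ret b)) (ret v))"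
proof -
  have "tauH' g (w @ [b]) =
      coact (ret w) (\<lambda>p v. sw (ret b) (\<lambda>x y. sc (E y) (consV (g \<star> S (ret p \<star> ret x)) (ret v))))"
    by (simp add: tauH'_def coact_snoc)
  then show ?thesis by simp
qed

text \<open>Coassociativity turns the coefficient into the trace of
  \<open>g \<star> S p \<star> q\<close>, where \<open>p\<close> and \<open>q\<close> are the two
  legs of one element; the antipode axiom leaves \<open>ev T g\<close>.\<close>

lemma gamma_theta:
  assumes "ev T g = 1" shows "bind (theta g w) (gamma T) = ret w"
proof -
  have "bind (theta g w) (gamma T) =
      coact (ret w) (\<lambda>r v. sw (ret r) (\<lambda>p q. sc (ev T (g \<star> (S (ret p) \<star> ret q))) (ret v)))"
    by (simp add: theta_def bind_consV_gamma mul_assoc coact_coassoc)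
  also have "\<dots> = ret w"
    by (simp add: sw_antipL[of "\<lambda>Z. sc (ev T (g \<star> Z)) Y" for Y] lin_intros assms)
  finally show ?thesis .
qed

text \<open>The counit in an outer face of the Hopf side undoes the splitting of the first or last
  letter under the trace. For the last face, cyclicity of the trace then moves that letter to the
  front.\<close>

lemma gamma_face:
  assumes len: "length w = Suc n" and n: "0 < n" "i \<le> n"
    and trace: "\<And>X Y. ev T (X \<star> Y) = ev T (Y \<star> X)"
  shows "bind (faceA' M n i w) (gamma T) = bind (gamma T w) (faceH' M E n i)"
proof -
  obtain a y where w: "w = a # y" and y: "length y = n" using len by (cases w) auto
  consider "i = 0" | "0 < i" "i < n" | "i = n" using n by linarith
  then show ?thesis
  proof cases
    case 1
    obtain b z where y: "y = b # z" using y n by (cases y) auto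
    have "bind (gamma T w) (faceH' M E n i) =
        sw (ret b) (\<lambda>x y. sc (E y) (coact (ret z) (\<lambda>p v. sc (ev T (ret a \<star> (ret x \<star> ret p))) (ret v))))"
      by (simp add: w y 1 gamma_def coact_Cons faceH'_def sc_commute)
    also have "\<dots> = bind (faceA' M n i w) (gamma T)"
      by (simp add: w y 1 n faceA'_def merge_0 bind_consV_gamma bind_coact_commute mul_assoc)
    finally show ?thesis ..
  next
    case 2
    then obtain j where j: "i = Suc j" by (cases i) auto
    then show ?thesis using 2 y
      by (simp add: w faceA'_def faceH'_def merge_Suc bind_consV_gamma coact_merge gamma_def)
  next
    case 3
    obtain z b where z: "y = z @ [b]" using y n by (cases y rule: rev_cases) auto
    have "bind (gamma T w) (faceH' M E n i) =
        coact (ret z) (\<lambda>p v. sw (ret b) (\<lambda>x y. sc (E y) (sc (ev T (ret a \<star> (ret p \<star> ret x))) (ret v))))"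
      using n by (simp add: w z 3 gamma_def coact_snoc faceH'_def sc_commute)
    also have "\<dots> = coact (ret z) (\<lambda>p v. sc (ev T (ret b \<star> ret a \<star> ret p)) (ret v))"
      by (simp add: trace[of "ret b"] mul_assoc)
    also have "\<dots> = bind (faceA' M n i w) (gamma T)"
    proof -
      have "faceA' M n i w = consV (ret b \<star> ret a) (ret z)"
        using n y by (simp add: w z 3 faceA'_def nth_Cons nth_append split: nat.splits)
      then show ?thesis by (simp add: bind_consV_gamma)
    qed
    finally show ?thesis ..
  qed
qed

text \<open>Invariance is applied to \<open>X \<star> y\<close>: this trades \<open>g\<close> for
  the second leg of that product, in which the part coming from \<open>Y\<close> cancels against the
  antipode. This identity moves an antipode across the trace.\<close>

lemma sw_trace:
  assumes inv: "\<And>X. sw X (\<lambda>x y. sc (T x) (ret y)) = sc (ev T X) g"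
  shows "sw Y (\<lambda>y z. sc (ev T (X \<star> ret y)) (g \<star> S (ret z))) = sw X (\<lambda>p q. sc (ev T (ret p \<star> Y)) (ret q))"
proof -
  have "sc (ev T X) (g \<star> Y) = sw X (\<lambda>x y. sc (T x) (ret y \<star> Y))" for X Y
    using arg_cong[OF inv[of X], of "\<lambda>Z. Z \<star> Y"] lin_sw_out[of "\<lambda>Z. Z \<star> Y" X "\<lambda>x y. sc (T x) (ret y)"]
    by (simp add: lin_intros)
  then have "sw Y (\<lambda>y z. sc (ev T (X \<star> ret y)) (g \<star> S (ret z))) =
      sw X (\<lambda>p q. sw Y (\<lambda>y z. sw (ret y) (\<lambda>r s. sc (ev T (ret p \<star> ret r)) (ret q \<star> (ret s \<star> S (ret z))))))"
    by (simp add: sw_mul bind_sc_fun sw_commute[of X] mul_assoc)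
  also have "\<dots> = sw X (\<lambda>p q. sw Y (\<lambda>r y. sw (ret y) (\<lambda>s z. sc (ev T (ret p \<star> ret r)) (ret q \<star> (ret s \<star> S (ret z))))))"
    by (simp only: sw_coassoc)
  also have "\<dots> = sw X (\<lambda>p q. sw Y (\<lambda>r y. sc (E y) (sc (ev T (ret p \<star> ret r)) (ret q))))"
    by (simp add: sw_antipR[of "\<lambda>Z. Q \<star> Z" for Q] lin_intros sc_commute)
  also have "\<dots> = sw X (\<lambda>p q. sc (ev T (ret p \<star> Y)) (ret q))"
    by simp
  finally show ?thesis .
qed

text \<open>With \<open>X = a\<close>, the identity \<open>sw_trace\<close> replaces the antipode
  produced by the Hopf cyclic operator by the coproduct of the zeroth letter
  \<open>a\<close>.\<close>

lemma gamma_tau: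
  assumes w: "w \<noteq> []"
    and trace: "\<And>X Y. ev T (X \<star> Y) = ev T (Y \<star> X)"
    and inv: "\<And>X. sw X (\<lambda>x y. sc (T x) (ret y)) = sc (ev T X) g"
  shows "bind (tauA' w) (gamma T) = bind (gamma T w) (tauH' g)"
proof -
  obtain a y where w: "w = a # y" using w by (cases w) auto
  show ?thesis
  proof (cases y rule: rev_cases)
    case Nil
    then show ?thesis by (simp add: w tauA'_def gamma_def tauH'_def)
  next
    case (snoc z b)
    let ?G = "\<lambda>p x p' y v. sc (ev T (ret a \<star> (ret p \<star> ret x))) (consV (g \<star> S (ret p' \<star> ret y)) (ret v))"
    have "bind (gamma T w) (tauH' g) = coact (ret z) (\<lambda>p v. sw (ret b) (\<lambda>x y.
        sc (ev T (ret a \<star> (ret p \<star> ret x))) (tauH' g (v @ [y]))))"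
      by (simp add: w snoc gamma_def coact_snoc)
    also have "\<dots> = coact (ret z) (\<lambda>p v. coact (ret v) (\<lambda>p' v'. sw (ret b) (\<lambda>x y. ?G p x p' y v')))"
      by (simp add: tauH'_snoc coact_sw_commute)
    also have "\<dots> = coact (ret z) (\<lambda>r v. sw (ret r) (\<lambda>p p'. sw (ret b) (\<lambda>x y. ?G p x p' y v)))"
      by (simp only: coact_coassoc)
    \<comment> \<open>Multiplicativity of the coproduct joins the two sums into one over
      \<open>r \<star> b\<close>, the form that \<open>sw_trace\<close> needs.\<close>
    also have "\<dots> = coact (ret z) (\<lambda>r v. sw (ret r \<star> ret b)
        (\<lambda>s t. consV (sc (ev T (ret a \<star> ret s)) (g \<star> S (ret t))) (ret v)))"
      by (simp add: sw_mul)
    also have "\<dots> = coact (ret z) (\<lambda>r v. consV (sw (ret r \<star> ret b)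
        (\<lambda>s t. sc (ev T (ret a \<star> ret s)) (g \<star> S (ret t)))) (ret v))"
      by (simp only: lin_sw_out[of "\<lambda>Z. consV Z V" for V] lin_intros)
    also have "\<dots> = coact (ret z) (\<lambda>r v. sw (ret a) (\<lambda>p q. sc (ev T (ret p \<star> (ret r \<star> ret b))) (consV (ret q) (ret v))))"
      by (simp only: sw_trace[OF inv] lin_sw_out[of "\<lambda>Z. consV Z V" for V] lin_intros consV_sc)
    also have "\<dots> = bind (tauA' w) (gamma T)"
      by (simp add: w snoc tauA'_def gamma_def coact_Cons coact_sw_commute trace[of "ret b"] mul_assoc
          consV_def del: consV_bind)
    finally show ?thesis ..
  qed
qed

text \<open>\<open>R X Y\<close> below is \<open>\<gamma>(Y \<otimes> X)\<close>.\<close>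

lemma antipode_square:
  assumes trace: "\<And>X Y. ev T (X \<star> Y) = ev T (Y \<star> X)"
    and inv: "\<And>X. sw X (\<lambda>x y. sc (T x) (ret y)) = sc (ev T X) g"
    and norm: "ev T g = 1"
  shows "g \<star> S (g \<star> S X) = X"
proof -
  define R where "R = (\<lambda>X Y. sw X (\<lambda>p q. sc (ev T (ret p \<star> Y)) (ret q)))"
  \<comment> \<open>This is \<open>sw_trace\<close> after turning the arguments of the trace:
    swapping the tensor factors corresponds to \<open>h \<mapsto> g \<star> S h\<close>.\<close>
  have flip: "g \<star> S (R Y X) = R X Y" for X Y
  proof -
    have "g \<star> S (R Y X) = sw Y (\<lambda>y z. g \<star> S (sc (ev T (X \<star> ret y)) (ret z)))"
      unfolding R_def trace[of X] by (rule lin_sw_out[of "\<lambda>Z. g \<star> S Z"]) (intro lin_intros)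
    then show ?thesis by (simp add: sw_trace[OF inv] R_def)
  qed
  \<comment> \<open>Every \<open>X\<close> is a sum of values of \<open>R\<close>: in
    \<open>Tr(g S(x\<^sub>1) x\<^sub>2) x\<^sub>3\<close> the antipode axiom leaves the factor
    \<open>Tr(g) = 1\<close>.\<close>
  have "sw X (\<lambda>x y. R (ret y) (g \<star> S (ret x))) =
      sw X (\<lambda>x y. sw (ret x) (\<lambda>x p. sc (ev T (g \<star> (S (ret x) \<star> ret p))) (ret y)))"
    by (simp add: R_def trace[of _ "g \<star> _"] mul_assoc flip: sw_coassoc)
  also have "\<dots> = X"
    by (simp add: sw_antipL[of "\<lambda>Z. sc (ev T (g \<star> Z)) Y" for Y] lin_intros norm)
  finally have X: "sw X (\<lambda>x y. R (ret y) (g \<star> S (ret x))) = X" .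
  have "g \<star> S (g \<star> S (sw X (\<lambda>x y. R (ret y) (g \<star> S (ret x))))) =
      sw X (\<lambda>x y. g \<star> S (g \<star> S (R (ret y) (g \<star> S (ret x)))))"
    by (rule lin_sw_out[of "\<lambda>Z. g \<star> S (g \<star> S Z)"]) (intro lin_intros)
  then show ?thesis unfolding flip X by (simp only: X)
qed

text \<open>Since \<open>S g = g\<^sup>-\<^sup>1\<close>, the hypothesis \<open>sq\<close> says \<open>S\<^sup>2(h) = g\<^sup>-\<^sup>1 h g\<close>.\<close>

lemma theta_tau:
  assumes sq: "\<And>X. g \<star> S (g \<star> S X) = X"
    and Dg: "bind g D = tens g g"
  shows "bind (tauH' g w) (theta g) = bind (theta g w) tauA'"
proof (cases w rule: rev_cases)
  case Nil
  then show ?thesis by (simp add: tauH'_def theta_def bind_consV S_unit tauA'_def)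
next
  case (snoc z b)
  \<comment> \<open>\<open>g\<close> is group-like and \<open>S\<close> reverses the coproduct, so
    the legs are \<open>g \<star> S t\<close> and \<open>g \<star> S s\<close>, in this
    order.\<close>
  have S_g: "sw (g \<star> S B) F = sw B (\<lambda>s t. bind (g \<star> S (ret t)) (\<lambda>p. bind (g \<star> S (ret s)) (\<lambda>q. F p q)))"
    for B and F :: "'b \<Rightarrow> 'b \<Rightarrow> 'b list \<Rightarrow>\<^sub>0 'k"
    by (simp add: sw_mul) (simp add: sw_def[of g] Dg bind_sw_commute sw_S bind_commute[of g]
        bind_commute[of "S _" "g \<star> _"])
  let ?G = "\<lambda>p1 p2 p' b1 b2 v. consV (g \<star> S (g \<star> (S (ret b2) \<star> (S (ret p2) \<star> ret p'))))
    (consV (g \<star> S (ret p1 \<star> ret b1)) (ret v))"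
  have "bind (tauH' g w) (theta g) = coact (ret z) (\<lambda>p v. coact (ret v) (\<lambda>p' v'. sw (ret p) (\<lambda>p1 p2. sw (ret b) (\<lambda>b1 b2.
      ?G p1 p2 p' b1 b2 v'))))"
    by (simp add: snoc tauH'_snoc bind_theta coact_consV S_g bind_coact_commute)
      (simp add: sw_mul S_mul[of "ret _" "ret _"] mul_assoc coact_sw_commute bind_coact_commute)
  also have "\<dots> = coact (ret z) (\<lambda>r v. sw (ret r) (\<lambda>p1 t. sw (ret t) (\<lambda>p2 p'. sw (ret b) (\<lambda>b1 b2. ?G p1 p2 p' b1 b2 v))))"
    by (simp only: coact_coassoc sw_coassoc)
  also have "\<dots> = coact (ret z) (\<lambda>r v. sw (ret b) (\<lambda>b1 b2. sw (ret r) (\<lambda>p1 t. sw (ret t) (\<lambda>p2 p'. ?G p1 p2 p' b1 b2 v))))"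
    by (simp only: sw_commute[of "ret b"])
  \<comment> \<open>\<open>S p2 \<star> p'\<close> cancels, which leaves
    \<open>g \<star> S (g \<star> S b2)\<close> in front; this is \<open>b2\<close> by
    \<open>sq\<close>.\<close>
  also have "\<dots> = coact (ret z) (\<lambda>r v. sw (ret b) (\<lambda>b1 b2. consV (ret b2) (consV (g \<star> S (ret r \<star> ret b1)) (ret v))))"
    by (simp add: sw_antipL[of "\<lambda>Z. consV (g \<star> S (g \<star> (S Y \<star> Z))) V" for Y V] lin_intros sq)
  also have "\<dots> = bind (theta g w) tauA'"
    by (simp add: snoc theta_def coact_snoc bind_consV tauA'_def consV_def[of "ret _"] del: consV_bind)
  finally show ?thesis .
qed

text \<open>For the first face the antipode of a first leg meets its second leg and cancels; inner
  faces follow from \<open>coact_merge\<close>. For the last face a letter first has to pass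
  \<open>g\<close>, at the cost of \<open>S\<close> applied twice.\<close>

lemma theta_face:
  assumes len: "length w = n" and n: "0 < n" "i \<le> n"
    and sq: "\<And>X. g \<star> S (g \<star> S X) = X"
    and Dg: "bind g D = tens g g" and Eg: "ev E g = 1"
  shows "bind (faceH' M E n i w) (theta g) = bind (theta g w) (faceA' M n i)"
proof -
  consider "i = 0" | "0 < i" "i < n" | "i = n" using n by linarith
  then show ?thesis
  proof cases
    case 1
    obtain a z where w: "w = a # z" using len n by (cases w) auto
    have "bind (theta g w) (faceA' M n i) =
        coact (ret z) (\<lambda>p v. sw (ret a) (\<lambda>x y. consV (g \<star> (S (ret p) \<star> (S (ret x) \<star> ret y))) (ret v)))"
      by (simp add: w 1 n theta_def coact_Cons faceA'_def bind_consV merge_0 S_mul mul_assoc coact_sw_commute)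
    also have "\<dots> = bind (faceH' M E n i w) (theta g)"
      by (simp add: sw_antipL[of "\<lambda>Z. consV (g \<star> (S Y \<star> Z)) V" for Y V] lin_intros
          w 1 faceH'_def theta_def)
    finally show ?thesis ..
  next
    case 2
    then obtain j where j: "i = Suc j" by (cases i) auto
    show ?thesis using 2 len
      by (simp add: j faceH'_def faceA'_def bind_theta coact_merge)
        (simp add: theta_def bind_consV merge_Suc faceA'_def)
  next
    case 3
    obtain z b where w: "w = z @ [b]" using len n by (cases w rule: rev_cases) auto
    have Sg: "S g \<star> g = U"
      using sw_antipL[of "\<lambda>Z. Z" g] by (simp add: lin_intros Eg) (simp add: sw_def Dg)
    \<comment> \<open>By \<open>sq\<close> and antimultiplicativity,
      \<open>X = g \<star> S (S X) \<star> S g\<close>, and \<open>S g\<close> is a left inverse of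
      \<open>g\<close>.\<close>
    have comm: "X \<star> g = g \<star> S (S X)" for X
    proof -
      have "X \<star> g = g \<star> S (g \<star> S X) \<star> g" by (simp only: sq)
      then show ?thesis by (simp add: S_mul mul_assoc Sg)
    qed
    have "bind (theta g w) (faceA' M n i) = coact (ret z) (\<lambda>p v. sw (ret b) (\<lambda>x y.
        bind (consV (g \<star> S (ret p \<star> ret x)) (ret (v @ [y]))) (faceA' M n i)))"
      by (simp add: w theta_def coact_snoc)
    also have "\<dots> = coact (ret z) (\<lambda>p v. sw (ret b) (\<lambda>x y. consV (ret y \<star> (g \<star> S (ret p \<star> ret x))) (ret v)))"
    proof (rule coact_cong)
      fix p :: 'b and v :: "'b list" assume "length v = length z"
      \<comment> \<open>As \<open>v\<close> has length \<open>n - 1\<close>, position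
        \<open>n\<close> of \<open>q # v @ [y]\<close> holds \<open>y\<close>, which the last face
        multiplies onto \<open>q\<close> from the left.\<close>
      then have "faceA' M n i (q # v @ [y]) = consV (ret y \<star> ret q) (ret v)" for q y :: 'b
        using len by (auto simp add: w 3 faceA'_def nth_append)
      then show "sw (ret b) (\<lambda>x y. bind (consV (g \<star> S (ret p \<star> ret x)) (ret (v @ [y]))) (faceA' M n i)) =
          sw (ret b) (\<lambda>x y. consV (ret y \<star> (g \<star> S (ret p \<star> ret x))) (ret v))"
        by (simp add: bind_consV)
    qed
    also have "\<dots> = coact (ret z) (\<lambda>p v. sw (ret b) (\<lambda>x y. consV (g \<star> (S (ret x \<star> S (ret y)) \<star> S (ret p))) (ret v)))"
    proof -
      have "ret y \<star> (g \<star> S (ret p \<star> ret x)) = g \<star> (S (ret x \<star> S (ret y)) \<star> S (ret p))" for x y p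
        using arg_cong[OF comm[of "ret y"], of "\<lambda>Z. Z \<star> S (ret p \<star> ret x)"]
        by (simp add: mul_assoc S_mul)
      then show ?thesis by simp
    qed
    also have "\<dots> = bind (faceH' M E n i w) (theta g)"
      using n by (simp add: sw_antipR[of "\<lambda>Z. consV (g \<star> (S Z \<star> S Y)) V" for Y V] lin_intros
          w 3 faceH'_def theta_def S_unit)
    finally show ?thesis ..
  qed
qed

end

section \<open>Star structures\<close>

text \<open>Antilinear maps are represented as coefficientwise conjugation followed by a linear
  \<open>bind\<close>.\<close>

definition cv :: "('k \<Rightarrow> 'k) \<Rightarrow> ('a \<Rightarrow>\<^sub>0 'k::comm_ring_1) \<Rightarrow> 'a \<Rightarrow>\<^sub>0 'k" where
  "cv cnj X = Poly_Mapping.map cnj X"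

definition starX :: "('k \<Rightarrow> 'k) \<Rightarrow> ('b \<Rightarrow> 'b \<Rightarrow>\<^sub>0 'k::comm_ring_1) \<Rightarrow> ('b \<Rightarrow>\<^sub>0 'k) \<Rightarrow> 'b \<Rightarrow>\<^sub>0 'k" where
  "starX cnj st X = bind (cv cnj X) st"

locale conjugation =
  fixes cnj :: "'k::field \<Rightarrow> 'k"
  assumes cnj_add: "cnj (x + y) = cnj x + cnj y"
    and cnj_mult: "cnj (x * y) = cnj x * cnj y"
    and cnj_cnj [simp]: "cnj (cnj x) = x"
begin

lemma cnj_0 [simp]: "cnj 0 = 0"
  using cnj_add[of 0 0] by (metis add.right_neutral add_left_cancel)

lemma cnj_1 [simp]: "cnj 1 = 1"
  using cnj_mult[of "cnj 1" 1] by simp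

lemma coef_cv [simp]: "coef (cv cnj X) a = cnj (coef X a)"
  by (cases "coef X a = 0") (auto simp: cv_def Poly_Mapping.map.rep_eq)

lemma cv_simps [simp]:
  "cv cnj 0 = 0" "cv cnj (ret a) = ret a" "cv cnj (cv cnj X) = X"
  "cv cnj (sc c X) = sc (cnj c) (cv cnj X)"
  by (auto intro!: poly_mapping_eqI simp: coef_ret cnj_mult)

lemma cv_add: "cv cnj (X + Y) = cv cnj X + cv cnj Y"
  by (auto intro!: poly_mapping_eqI simp: lookup_add cnj_add)

lemma cv_bind: "cv cnj (bind X F) = bind (cv cnj X) (\<lambda>a. cv cnj (F a))"
  by (induction X rule: vec_induct) (auto simp: bind_add cv_add)

lemma cv_bind2: "cv cnj (bind2 X F) = bind2 (cv cnj X) (\<lambda>a b. cv cnj (F a b))"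
  by (simp add: bind2_def cv_bind)

lemma cv_tens: "cv cnj (tens X Y) = tens (cv cnj X) (cv cnj Y)"
  by (simp add: tens_def cv_bind del: tens_bind)

lemma cv_consV: "cv cnj (consV X Y) = consV (cv cnj X) (cv cnj Y)"
  by (simp add: consV_def cv_bind del: consV_bind)

lemma ev_cv: "ev f (cv cnj X) = cnj (ev (\<lambda>a. cnj (f a)) X)"
  by (induction X rule: vec_induct) (auto simp: cv_add ev_add cnj_add cnj_mult)

end

locale hopf_star = hopf M U D E A + conjugation cnj
  for M :: "'b \<Rightarrow> 'b \<Rightarrow> 'b \<Rightarrow>\<^sub>0 'k::field" and U D E A and cnj :: "'k \<Rightarrow> 'k" +
  fixes st :: "'b \<Rightarrow> 'b \<Rightarrow>\<^sub>0 'k"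
  assumes star_star: "starX cnj st (starX cnj st X) = X"
    and star_comul: "bind (starX cnj st X) D = bind2 (cv cnj (bind X D)) (\<lambda>x y. tens (st y) (st x))"
    and star_mul: "starX cnj st (mulV M X Y) = mulV M (starX cnj st X) (starX cnj st Y)"
    and star_unit: "starX cnj st U = U"
    and S_star_S_star: "bind (starX cnj st (bind (starX cnj st X) A)) A = X"
begin

abbreviation star where "star \<equiv> starX cnj st"
abbreviation conj where "conj X \<equiv> cv cnj X"

text \<open>By \<open>S_star\<close> below this is also the inverse antipode of
  \<open>star X\<close>, so one map serves the involutions of both complexes.\<close>

definition bar :: "('b \<Rightarrow>\<^sub>0 'k) \<Rightarrow> 'b \<Rightarrow>\<^sub>0 'k" where
  "bar X = star (S X)"

text \<open>The sum that arises when an antilinear map is moved inside a Sweedler sum;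
  \<open>ccoact\<close> plays the same role for the coaction.\<close>

definition csw :: "('b \<Rightarrow>\<^sub>0 'k) \<Rightarrow> ('b \<Rightarrow> 'b \<Rightarrow> 'c \<Rightarrow>\<^sub>0 'k) \<Rightarrow> 'c \<Rightarrow>\<^sub>0 'k" where
  "csw X F = bind2 (conj (bind X D)) F"

definition ccoact :: "('b list \<Rightarrow>\<^sub>0 'k) \<Rightarrow> ('b \<Rightarrow> 'b list \<Rightarrow> 'c \<Rightarrow>\<^sub>0 'k) \<Rightarrow> 'c \<Rightarrow>\<^sub>0 'k" where
  "ccoact W F = bind2 (conj (bind W coaction)) F"

lemma conj_sw: "conj (sw X F) = csw X (\<lambda>x y. conj (F x y))"
  by (simp add: sw_def[of X] csw_def cv_bind2 del: bind2_bind)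

lemma conj_coact: "conj (coact X F) = ccoact X (\<lambda>x y. conj (F x y))"
  by (simp add: coact_def[of X] ccoact_def cv_bind2 del: bind2_bind)

lemma bind_csw [simp]: "bind (csw X F) G = csw X (\<lambda>x y. bind (F x y) G)"
  by (simp add: csw_def)

lemma bind_ccoact [simp]: "bind (ccoact X F) G = ccoact X (\<lambda>x y. bind (F x y) G)"
  by (simp add: ccoact_def)

lemma ccoact_csw_commute: "ccoact W (\<lambda>p v. csw X (F p v)) = csw X (\<lambda>x y. ccoact W (\<lambda>p v. F p v x y))"
  unfolding ccoact_def csw_def by (rule bind2_commute)

lemma bind_csw_commute: "bind X (\<lambda>a. csw Y (F a)) = csw Y (\<lambda>x y. bind X (\<lambda>a. F a x y))"
  unfolding csw_def by (rule bind_bind2_commute)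

lemma S_star: "S (star (S X)) = star X"
  using S_star_S_star[of "star X"] by (simp add: S_def star_star)

lemma bar_bar: "bar (bar X) = X"
  by (simp add: bar_def S_star star_star)

lemma bar_mul: "bar (X \<star> Y) = bar Y \<star> bar X"
  by (simp add: bar_def S_mul star_mul)

lemma bar_unit: "bar U = U"
  by (simp add: bar_def S_unit star_unit)

lemma bind_star: "bind (conj X) (\<lambda>a. star (F a)) = star (bind X F)"
  by (simp add: starX_def cv_bind)

lemma bind_bar: "bind (conj X) (\<lambda>a. bar (F a)) = bar (bind X F)"
  by (simp add: bar_def bind_star)

lemma bind_conj_bar: "bind (conj X) (\<lambda>a. bind (bar (ret a)) F) = bind (bar X) F"
  using bind_bar[of X ret] by (simp flip: bind_assoc)

lemma star_sc: "star (sc c X) = sc (cnj c) (star X)"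
  by (simp add: starX_def)

lemma bar_sc: "bar (sc c X) = sc (cnj c) (bar X)"
  by (simp add: bar_def star_sc)

lemma bar_sw: "bar (sw X F) = csw X (\<lambda>x y. bar (F x y))"
proof -
  have "bar (sw X F) = bind (conj (sw X F)) (\<lambda>a. bar (ret a))"
    by (simp add: bind_bar)
  then show ?thesis by (simp add: conj_sw bind_bar)
qed

text \<open>Both the antipode and the star reverse the coproduct, so their composite preserves
  it.\<close>

lemma bar_comul: "bind (bar X) D = csw X (\<lambda>x y. tens (bar (ret x)) (bar (ret y)))"
proof -
  have "bind (bar X) D = bind2 (conj (sw X (\<lambda>x y. tens (S (ret y)) (S (ret x))))) (\<lambda>x y. tens (st y) (st x))"
    by (simp add: bar_def star_comul S_comul)
  also have "\<dots> = csw X (\<lambda>x y. tens (star (S (ret x))) (star (S (ret y))))"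
    by (simp add: conj_sw cv_tens starX_def csw_def)
  finally show ?thesis by (simp add: bar_def)
qed

lemma sw_bar: "sw (bar X) F = csw X (\<lambda>x y. bind (bar (ret x)) (\<lambda>p. bind (bar (ret y)) (\<lambda>q. F p q)))"
  by (simp add: sw_def[of "bar X"] bar_comul del: bind2_bind) (simp add: csw_def)

section \<open>The involutions of the two complexes\<close>

primrec omH :: "'b list \<Rightarrow> 'b list \<Rightarrow>\<^sub>0 'k" where
  "omH [] = ret []"
| "omH (a # w) = bind (omH w) (\<lambda>v. bind (bar (ret a)) (\<lambda>c. ret (v @ [c])))"

definition omA :: "'b list \<Rightarrow> 'b list \<Rightarrow>\<^sub>0 'k" where
  "omA w = consV (bar (ret (hd w))) (omH (tl w))"

lemma ccoact_Nil: "ccoact (ret []) F = bind (conj U) (\<lambda>p. F p [])"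
  by (simp add: ccoact_def cv_tens)

lemma ccoact_Cons: "ccoact (ret (a # w)) F =
    csw (ret a) (\<lambda>x y. ccoact (ret w) (\<lambda>p v. bind (conj (ret x \<star> ret p)) (\<lambda>q. F q (y # v))))"
  by (simp add: ccoact_def conj_sw cv_bind2 cv_tens) (simp add: csw_def)

text \<open>\<open>bar\<close> preserves coproducts and reverses products, so the first legs of the
  reversed word multiply to \<open>bar\<close> of the original product.\<close>

lemma coact_omH: "coact (omH w) F =
    ccoact (ret w) (\<lambda>p v. bind (bar (ret p)) (\<lambda>q. bind (omH v) (\<lambda>v'. F q v')))"
proof (induction w arbitrary: F)
  case Nil
  then show ?case
    using bind_bar[of U ret] by (simp add: ccoact_Nil bar_unit flip: bind_assoc)
next
  case (Cons a w)
  let ?F = "\<lambda>p x v y. bind (bar (ret p) \<star> bar (ret x)) (\<lambda>r. bind (omH v) (\<lambda>v. bind (bar (ret y)) (\<lambda>c. F r (v @ [c]))))"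
  have "coact (omH (a # w)) F = coact (omH w) (\<lambda>p v. sw (bar (ret a)) (\<lambda>x y. bind (ret p \<star> ret x) (\<lambda>r. F r (v @ [y]))))"
    by (simp add: coact_snoc bind_coact_commute bind_ret_sw)
      (simp add: bind_ret_coact bind_ret_sw flip: coact_sw_commute bind_coact_commute)
  also have "\<dots> = csw (ret a) (\<lambda>x y. ccoact (ret w) (\<lambda>p v. ?F p x v y))"
    by (simp add: Cons.IH sw_bar ccoact_csw_commute bind_csw_commute bind_commute[of "bar _" "_ \<star> _"]
        bind_commute[of "omH _" "_ \<star> _"])
  also have "\<dots> = ccoact (ret (a # w)) (\<lambda>p v. bind (bar (ret p)) (\<lambda>q. bind (omH v) (\<lambda>v'. F q v')))"
    by (simp add: ccoact_Cons bind_conj_bar bar_mul)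
  finally show ?case .
qed

text \<open>\<open>bar a \<star> bar p\<close> is \<open>bar (p \<star> a)\<close>; reality and
  cyclicity of the trace turn its value into the conjugate of that of
  \<open>a \<star> p\<close>.\<close>

lemma gamma_om:
  assumes w: "w \<noteq> []"
    and trace: "\<And>X Y. ev T (X \<star> Y) = ev T (Y \<star> X)"
    and real: "\<And>X. ev T (bar X) = cnj (ev T X)"
  shows "bind (omA w) (gamma T) = bind (conj (gamma T w)) omH"
proof -
  obtain a y where w: "w = a # y" using w by (cases w) auto
  have "ev T (bar (ret a) \<star> bar (ret p)) = cnj (ev T (ret a \<star> ret p))" for p
    by (simp add: trace[of "ret a"] real flip: bar_mul)
  then show ?thesis
    by (simp add: w omA_def bind_consV_gamma coact_omH gamma_def conj_coact)
qed

text \<open>Both sides equal \<open>g \<star> star X\<close>. For the left side, \<open>sq\<close>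
  gives \<open>S (S X) \<star> gi = gi \<star> X\<close>, to which the star is applied.\<close>

lemma bar_group_like:
  assumes sq: "\<And>X. g \<star> S (g \<star> S X) = X"
    and g: "S g = gi" "star gi = g" "g \<star> gi = U" "gi \<star> g = U"
  shows "bar (g \<star> S X) = g \<star> S (bar X)"
proof -
  have "S (S X) \<star> gi = gi \<star> (g \<star> S (g \<star> S X))"
    by (simp add: S_mul g mul_assoc[symmetric])
  then have "S (S X) \<star> gi = gi \<star> X" by (simp only: sq)
  then have "star (S (S X) \<star> gi) = star gi \<star> star X" by (simp add: star_mul)
  moreover have "star g = gi" using g(2) star_star[of gi] by simp
  ultimately show ?thesis
    by (simp add: bar_def S_mul S_star g)
qed

lemma theta_om:
  assumes "\<And>X. bar (g \<star> S X) = g \<star> S (bar X)"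
  shows "bind (omH w) (theta g) = bind (conj (theta g w)) omA"
proof -
  have "bind (conj (consV X (ret v))) omA = consV (bar X) (omH v)" for X v
    using bind_bar[of X ret] by (simp add: cv_consV bind_consV omA_def del: consV_bind(2))
  then show ?thesis
    by (simp add: bind_theta coact_omH theta_def conj_coact assms)
qed

text \<open>The conjugate of the trace under \<open>bar\<close> is again an invariant trace:
  \<open>bar\<close> reverses products, preserves coproducts and fixes \<open>g\<close>.\<close>

lemma real_trace:
  assumes trace: "\<And>X Y. ev T (X \<star> Y) = ev T (Y \<star> X)"
    and inv: "\<And>X. sw X (\<lambda>x y. sc (T x) (ret y)) = sc (ev T X) g"
    and nz: "ev T g \<noteq> 0" and bar_g: "bar g = g" and two: "(2::'k) \<noteq> 0"
  obtains R where "\<And>X Y. ev R (X \<star> Y) = ev R (Y \<star> X)"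
    and "\<And>X. sw X (\<lambda>x y. sc (R x) (ret y)) = sc (ev R X) g"
    and "ev R g = 1" and "\<And>X. ev R (bar X) = cnj (ev R X)"
proof -
  \<comment> \<open>The scaling comes before the averaging, since the sum of \<open>ev T g\<close>
    and its conjugate could vanish.\<close>
  define c where "c = 1 / ev T g"
  define N where "N = (\<lambda>a. c * T a)"
  define R where "R = (\<lambda>a. (N a + cnj (ev N (bar (ret a)))) / 2)"
  have N: "ev N X = c * ev T X" for X
    by (simp add: ev_def N_def sum_distrib_left mult_ac)
  have bar_N: "ev (\<lambda>a. cnj (ev N (bar (ret a)))) X = cnj (ev N (bar X))" for X
    using ev_cv[of "\<lambda>a. ev N (bar (ret a))" X] bind_bar[of X ret] ev_bind[of N "conj X" "\<lambda>a. bar (ret a)"]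
    by (metis bind_ret cnj_cnj)
  have R: "ev R X = (ev N X + cnj (ev N (bar X))) / 2" for X
    using bar_N[of X] by (simp add: ev_def R_def sum.distrib ring_distribs flip: sum_divide_distrib)
  have sym: "cnj (ev N (bar (X \<star> Y))) = cnj (ev N (bar (Y \<star> X)))" for X Y
    by (simp add: bar_mul N trace)
  have inv_N: "sw X (\<lambda>x y. sc (N x) (ret y)) = sc (ev N X) g" for X
    using N[of X] by (simp add: N_def inv flip: sc_sc)
  have inv_bar: "sw X (\<lambda>x y. sc (cnj (ev N (bar (ret x)))) (ret y)) = sc (cnj (ev N (bar X))) g" for X
  proof -
    \<comment> \<open>Stated for \<open>bar Z\<close>, whose coproduct can be expanded; since
      \<open>bar\<close> is an involution, every \<open>X\<close> has this form.\<close>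
    have "sw (bar Z) (\<lambda>x y. sc (cnj (ev N (bar (ret x)))) (ret y)) = sc (cnj (ev N Z)) g" for Z
    proof -
      have "sw (bar Z) (\<lambda>x y. sc (cnj (ev N (bar (ret x)))) (ret y)) =
          csw Z (\<lambda>x y. sc (cnj (N x)) (bar (ret y)))"
        by (simp add: sw_bar bind_sc_fun bar_N bar_bar)
      also have "\<dots> = bar (sw Z (\<lambda>x y. sc (N x) (ret y)))"
        by (simp add: bar_sw bar_sc)
      finally show ?thesis by (simp add: inv_N bar_sc bar_g)
    qed
    from this[of "bar X"] show ?thesis by (simp add: bar_bar)
  qed
  have "sw X (\<lambda>x y. sc (R x) (ret y)) = sc (ev R X) g" for X
  proof -
    have split: "sc ((a + b) / 2) Y = sc (1/2) (sc a Y) + sc (1/2) (sc b Y)" for a b and Y :: "'b \<Rightarrow>\<^sub>0 'k"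
      by (simp add: sc_sc flip: sc_add_scalar) (simp add: add_divide_distrib)
    have "sw X (\<lambda>x y. sc (R x) (ret y)) = sc (1/2) (sw X (\<lambda>x y. sc (N x) (ret y))) +
        sc (1/2) (sw X (\<lambda>x y. sc (cnj (ev N (bar (ret x)))) (ret y)))"
      by (simp add: R_def split sw_def bind2_def bind_fun_add)
    then show ?thesis by (simp add: inv_N inv_bar R split)
  qed
  moreover have "ev R g = 1"
    using nz two by (simp add: R bar_g N c_def)
  moreover have "ev R (bar X) = cnj (ev R X)" for X
  proof -
    \<comment> \<open>Conjugation fixes \<open>1 / 2\<close>, so it commutes with the
      averaging.\<close>
    have "cnj (1 / 2) * 2 = cnj (1 / 2 * (1 + 1))"
      unfolding cnj_mult cnj_add by simp
    then have "cnj (1 / 2) = 1 / 2" using two by (simp add: field_simps)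
    then have "cnj (x / 2) = cnj x / 2" for x using cnj_mult[of x "1 / 2"] by simp
    then show ?thesis by (simp add: R bar_bar cnj_add add.commute)
  qed
  moreover have "ev R (X \<star> Y) = ev R (Y \<star> X)" for X Y
    by (simp only: R sym[of X Y]) (simp only: N trace[of X Y])
  ultimately show thesis by (intro that)
qed

end

section \<open>Translation to functions\<close>

lemma fsupp_coef [simp]: "fsupp (coef X) = Poly_Mapping.keys X"
  by (auto simp: fsupp_def in_keys_iff)

lemma coef_fvec [simp]: "coef X \<in> fvec"
  by (simp add: fvec_def)

lemma fvecE:
  assumes "x \<in> fvec" obtains X where "x = coef X"
  using assms that[of "Poly_Mapping.Abs_poly_mapping x"] by (auto simp: fvec_def fsupp_def)

lemma coef_eq_iff [simp]: "coef X = coef Y \<longleftrightarrow> X = Y"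
  by (auto intro: poly_mapping_eqI)

lemma bvec_coef: "bvec a = coef (ret a)"
  by (auto simp: bvec_def coef_ret)

lemma scal_coef: "scal c (coef X) = coef (sc c X)"
  by (auto simp: scal_def)

lemma plus_coef: "coef X + coef Y = coef (X + Y)"
  by (auto simp: lookup_add)

lemma zero_coef: "0 = coef 0"
  by (auto simp: fun_eq_iff)

lemma lext_coef:
  assumes "\<And>a. a \<in> Poly_Mapping.keys X \<Longrightarrow> F a = coef (G a)"
  shows "lext F (coef X) = coef (bind X G)"
  using assms by (auto simp: lext_def coef_bind intro!: sum.cong)

lemma (in conjugation) alext_coef:
  assumes "\<And>a. a \<in> Poly_Mapping.keys X \<Longrightarrow> F a = coef (G a)"
  shows "alext cnj F (coef X) = coef (bind (cv cnj X) G)"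
proof -
  \<comment> \<open>An involution that fixes 0 leaves the support unchanged.\<close>
  have "Poly_Mapping.keys (cv cnj X) = Poly_Mapping.keys X"
    by (auto simp: in_keys_iff) (metis cnj_0 cnj_cnj)
  then show ?thesis using assms by (auto simp: alext_def coef_bind intro!: sum.cong)
qed

lemma lfun_coef: "lfun f (coef X) = ev f X"
  by (simp add: lfun_def ev_def)

lemma TP_iff: "coef X \<in> TP n \<longleftrightarrow> (\<forall>w\<in>Poly_Mapping.keys X. length w = n)"
  by (auto simp: TP_def in_keys_iff)

lemma TP_E:
  assumes "x \<in> TP n"
  obtains X where "x = coef X" "\<And>w. w \<in> Poly_Mapping.keys X \<Longrightarrow> length w = n"
proof -
  have "x \<in> fvec" using assms by (simp add: TP_def fvec_def)
  then obtain X where "x = coef X" by (rule fvecE)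
  then show thesis using that[of X] assms by (simp add: TP_iff)
qed

section \<open>Tensors and concatenation in the two descriptions\<close>

definition tns :: "('b \<Rightarrow>\<^sub>0 'k::comm_ring_1) list \<Rightarrow> 'b list \<Rightarrow>\<^sub>0 'k" where
  "tns Xs = foldr consV Xs (ret [])"

lemma tns_simps [simp]: "tns [] = ret []" "tns (X # Xs) = consV X (tns Xs)"
  by (simp_all add: tns_def)

lemma coef_consV_Nil [simp]: "coef (consV X W) [] = 0"
proof (induction X rule: vec_induct)
  case (ret a)
  show ?case
    by (induction W rule: vec_induct)
      (auto simp: consV_def bind_add lookup_add coef_ret simp del: consV_bind)
qed (auto simp: consV_def bind_add lookup_add simp del: consV_bind)

lemma coef_consV_Cons [simp]: "coef (consV X W) (b # v) = coef X b * coef W v"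
proof (induction X rule: vec_induct)
  case (ret a)
  show ?case
    by (induction W rule: vec_induct)
      (auto simp: consV_def bind_add lookup_add coef_ret algebra_simps simp del: consV_bind)
qed (auto simp: consV_def bind_add lookup_add algebra_simps simp del: consV_bind)

lemma tensl_Nil: "tensl [] = bvec []"
  by (auto simp: tensl_def bvec_def)

lemma tensl_Cons: "tensl (x # xs) (b # v) = x b * tensl xs v"
  by (auto simp: tensl_def prod.lessThan_Suc_shift simp del: prod.lessThan_Suc)

lemma tensl_coef: "tensl (map coef Xs) = coef (tns Xs)"
proof (induction Xs)
  case (Cons X Xs)
  have "tensl (map coef (X # Xs)) w = coef (tns (X # Xs)) w" for w
    by (cases w) (auto simp: tensl_Cons Cons, simp add: tensl_def)
  then show ?case by auto
qed (simp add: tensl_Nil bvec_coef)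

lemma tns_append: "tns (Xs @ Ys) = bind (tns Xs) (\<lambda>v. bind (tns Ys) (\<lambda>w. ret (v @ w)))"
proof (induction Xs)
  case (Cons X Xs)
  then show ?case
    by (simp add: consV_def bind_commute[of X] del: consV_bind)
qed simp

lemma tns_map_ret [simp]: "tns (map ret w) = ret w"
  by (induction w) (auto simp: consV_def simp del: consV_bind)

text \<open>For basis words \<open>a\<close> and \<open>b\<close> only the cut at
  \<open>length a\<close> can contribute; linearity in each argument does the rest.\<close>

lemma tprod_coef: "tprod (coef X) (coef Y) = coef (bind X (\<lambda>v. bind Y (\<lambda>w. ret (v @ w))))"
proof
  fix w
  have base: "(\<Sum>i\<le>length w. coef (ret a) (take i w) * coef (ret b) (drop i w)) = (coef (ret (a @ b)) w :: 'b)"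
    for a b :: "'a list"
  proof -
    have eq: "coef (ret a) (take i w) * coef (ret b) (drop i w) =
        (if i = length a then coef (ret (a @ b)) w else (0 :: 'b))" if "i \<le> length w" for i
    proof -
      have "a = take i w \<and> b = drop i w \<longleftrightarrow> i = length a \<and> a @ b = w"
        using that by (auto simp: append_eq_conv_conj)
      moreover have "coef (ret a) (take i w) * coef (ret b) (drop i w) =
          (if a = take i w \<and> b = drop i w then 1 else (0 :: 'b))"
        unfolding coef_ret by (cases "a = take i w"; cases "b = drop i w") (simp_all only: if_True if_False, simp_all)
      ultimately show ?thesis
        by (cases "i = length a"; cases "a @ b = w") (simp_all only: coef_ret if_True if_False, simp_all)
    qed
    then have "(\<Sum>i\<le>length w. coef (ret a) (take i w) * coef (ret b) (drop i w)) =
        (\<Sum>i\<le>length w. if i = length a then coef (ret (a @ b)) w else (0 :: 'b))"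
      by (intro sum.cong) auto
    then show ?thesis by (auto simp: coef_ret)
  qed
  have "(\<Sum>i\<le>length w. coef (ret a) (take i w) * coef Y (drop i w)) = coef (bind Y (\<lambda>w. ret (a @ w))) w" for a
  proof (induction Y rule: vec_induct)
    case (ret b)
    show ?case using base[of a b] by simp
  qed (simp_all add: bind_add lookup_add algebra_simps sum.distrib flip: sum_distrib_left)
  then have "(\<Sum>i\<le>length w. coef X (take i w) * coef Y (drop i w)) = coef (bind X (\<lambda>v. bind Y (\<lambda>w. ret (v @ w)))) w"
  proof (induction X rule: vec_induct)
    case (add X X')
    then show ?case by (simp add: bind_add lookup_add algebra_simps sum.distrib)
  next
    case (sc c X)
    then show ?case by (simp add: mult.assoc flip: sum_distrib_left)
  qed simp_all
  then show "tprod (coef X) (coef Y) w = coef (bind X (\<lambda>v. bind Y (\<lambda>w. ret (v @ w)))) w"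
    by (simp add: tprod_def)
qed

lemma mulH_coef: "mulH (\<lambda>a b. coef (M a b)) (coef X) (coef Y) = coef (mulV M X Y)"
  unfolding mulH_def mulV_def by (intro lext_coef) simp

lemma mulT_coef: "mulT (\<lambda>a b. coef (M a b)) (coef V) (coef W) =
  coef (bind V (\<lambda>v. bind W (\<lambda>w. if length v = length w then tns (map2 M v w) else 0)))"
proof -
  have "map2 (\<lambda>a b. coef (M a b)) v w = map coef (map2 M v w)" for v w
    by (simp add: case_prod_beta)
  then show ?thesis
    unfolding mulT_def by (intro lext_coef) (simp only: tensl_coef if_distrib[of coef] zero_coef)
qed

text \<open>The bridge between pairs, used for the coproduct in the locales, and words of length
  two, used in the given definitions.\<close>

definition words2 :: "('b \<times> 'b \<Rightarrow>\<^sub>0 'k::comm_ring_1) \<Rightarrow> 'b list \<Rightarrow>\<^sub>0 'k" where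
  "words2 P = bind2 P (\<lambda>x y. ret [x, y])"

lemma words2E:
  assumes "x \<in> TP 2" obtains P where "x = coef (words2 P)"
proof -
  obtain X where X: "x = coef X" "\<And>w. w \<in> Poly_Mapping.keys X \<Longrightarrow> length w = 2"
    using TP_E[OF assms] by blast
  have "ret [w ! 0, w ! 1] = (ret w :: 'a list \<Rightarrow>\<^sub>0 'b)" if "length w = 2" for w :: "'a list"
    using that by (cases w; cases "tl w") auto
  then have "bind X (\<lambda>w. ret [w ! 0, w ! 1]) = bind X ret"
    using X(2) by (intro bind_cong_keys) simp
  then show thesis using X(1) that[of "bind X (\<lambda>w. ret (w ! 0, w ! 1))"] by (simp add: words2_def)
qed

lemma bind_words2 [simp]: "bind (words2 P) F = bind2 P (\<lambda>x y. F [x, y])"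
  by (simp add: words2_def)

lemma words2_tens: "words2 (tens X Y) = consV X (consV Y (ret []))"
  by (simp add: words2_def consV_def del: consV_bind)

lemma words2_inj: "words2 P = words2 Q \<longleftrightarrow> P = Q"
proof -
  have "bind (words2 P) (\<lambda>w. ret (w ! 0, w ! 1)) = P" for P :: "'a \<times> 'a \<Rightarrow>\<^sub>0 'b"
    by (simp add: bind2_ret)
  then show ?thesis by metis
qed

lemma tmap_words2:
  assumes "\<And>a. F a = coef (F' a)" "\<And>a. G a = coef (G' a)"
  shows "tmap [F, G] (coef (words2 P)) =
    coef (bind2 P (\<lambda>x y. bind (F' x) (\<lambda>v. bind (G' y) (\<lambda>w. ret (v @ w)))))"
proof -
  have "tmap [F, G] (coef (words2 P)) = coef (bind (words2 P) (\<lambda>w. if length w = 2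
      then bind (F' (w ! 0)) (\<lambda>v. bind (G' (w ! 1)) (\<lambda>v'. ret (v @ v'))) else 0))"
    unfolding tmap_def
  proof (rule lext_coef)
    fix w :: "'a list"
    show "(if length w = length [F, G] then foldr tprod (map2 (\<lambda>F a. F a) [F, G] w) (bvec []) else 0) =
        coef (if length w = 2 then bind (F' (w ! 0)) (\<lambda>v. bind (G' (w ! 1)) (\<lambda>v'. ret (v @ v'))) else 0)"
      by (cases w; cases "tl w") (auto simp: assms bvec_coef tprod_coef fun_eq_iff)
  qed
  then show ?thesis by simp
qed

lemma lext_words2:
  assumes "\<And>x y. F [x, y] = coef (G x y)"
  shows "lext (\<lambda>w. if length w = 2 then F w else 0) (coef (words2 P)) = coef (bind2 P G)"
proof -
  have "lext (\<lambda>w. if length w = 2 then F w else 0) (coef (words2 P)) =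
      coef (bind (words2 P) (\<lambda>w. if length w = 2 then G (w ! 0) (w ! 1) else 0))"
  proof (rule lext_coef)
    fix w :: "'a list"
    show "(if length w = 2 then F w else 0) = coef (if length w = 2 then G (w ! 0) (w ! 1) else 0)"
      by (cases w; cases "tl w") (auto simp: assms fun_eq_iff)
  qed
  then show ?thesis by simp
qed

section \<open>From the given axioms to the locales\<close>

lemma lext_basis: "lext (\<lambda>a. coef (G a)) (coef X) = coef (bind X G)"
  by (rule lext_coef) simp

text \<open>The axioms are tested on vectors \<open>coef X\<close>; identities between words of
  length two descend to pairs because \<open>words2\<close> is injective.\<close>

lemma hopf_algebraD:
  assumes "hopf_algebra (\<lambda>a b. coef (M a b)) (coef U) (\<lambda>a. coef (words2 (D a))) E (\<lambda>a. coef (A a))"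
  shows "hopf M U D E A"
proof -
  let ?m = "\<lambda>a b. coef (M a b)" and ?u = "coef U" and ?cm = "\<lambda>a. coef (words2 (D a))" and ?S = "\<lambda>a. coef (A a)"
  note H = assms[unfolded hopf_algebra_def]
  have DW: "bind X (\<lambda>a. words2 (D a)) = words2 (bind X D)" for X
    by (simp add: words2_def)
  have idL: "idL a = coef (ret [a])" for a :: 'a
    by (simp add: idL_def bvec_coef)
  have epsL: "epsL E a = coef (sc (E a) (ret []))" for a :: 'a
    by (simp add: epsL_def bvec_coef scal_coef)
  show ?thesis
  proof
    have assoc: "\<forall>x\<in>fvec. \<forall>y\<in>fvec. \<forall>z\<in>fvec. mulH ?m (mulH ?m x y) z = mulH ?m x (mulH ?m y z)"
      using H by (elim conjE)
    show "mulV M (mulV M X Y) Z = mulV M X (mulV M Y Z)" for X Y Z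
      using assoc[rule_format, of "coef X" "coef Y" "coef Z"] by (simp add: mulH_coef)
    have unit: "\<forall>x\<in>fvec. mulH ?m ?u x = x \<and> mulH ?m x ?u = x"
      using H by (elim conjE)
    show "mulV M U X = X" "mulV M X U = X" for X
      using unit[rule_format, of "coef X"] by (simp_all add: mulH_coef)
    have coassoc: "\<forall>a. tmap [?cm, idL] (?cm a) = tmap [idL, ?cm] (?cm a)"
      using H by (elim conjE)
    have "bind2 (D a) (\<lambda>x y. bind2 (D x) (\<lambda>p q. ret [p, q, y])) =
        bind2 (D a) (\<lambda>x y. bind2 (D y) (\<lambda>p q. ret [x, p, q]))" for a
      using coassoc[rule_format, of a] by (simp add: tmap_words2[OF refl idL] tmap_words2[OF idL refl])
    \<comment> \<open>Reading off the letters turns words of length three into triples.\<close>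
    from arg_cong[OF this, of "\<lambda>W. bind W (\<lambda>w. ret (w ! 0, w ! 1, w ! 2))"]
    show "bind2 (D a) (\<lambda>x y. bind2 (D x) (\<lambda>p q. ret (p, q, y))) =
        bind2 (D a) (\<lambda>x y. bind2 (D y) (\<lambda>p q. ret (x, p, q)))" for a
      by simp
    have counit: "\<forall>a. tmap [epsL E, idL] (?cm a) = bvec [a] \<and> tmap [idL, epsL E] (?cm a) = bvec [a]"
      using H by (elim conjE)
    have counit': "bind2 (D a) (\<lambda>x y. sc (E x) (ret [y])) = ret [a]"
        "bind2 (D a) (\<lambda>x y. sc (E y) (ret [x])) = ret [a]" for a
      using counit[rule_format, of a]
      by (simp_all add: tmap_words2[OF epsL idL] tmap_words2[OF idL epsL] bvec_coef)
    show "bind2 (D a) (\<lambda>x y. sc (E x) (ret y)) = ret a" "bind2 (D a) (\<lambda>x y. sc (E y) (ret x)) = ret a" for a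
      using arg_cong[OF counit'(1)[of a], of "\<lambda>W. bind W (\<lambda>w. ret (hd w))"]
        arg_cong[OF counit'(2)[of a], of "\<lambda>W. bind W (\<lambda>w. ret (hd w))"] by simp_all
    have Dmul: "\<forall>x\<in>fvec. \<forall>y\<in>fvec. lext ?cm (mulH ?m x y) = mulT ?m (lext ?cm x) (lext ?cm y)"
      using H by (elim conjE)
    show "bind (mulV M X Y) D = bind2 (bind X D) (\<lambda>x x'. bind2 (bind Y D)
        (\<lambda>y y'. tens (mulV M (ret x) (ret y)) (mulV M (ret x') (ret y'))))" for X Y
    proof -
      have "words2 (bind (mulV M X Y) D) = bind2 (bind X D) (\<lambda>x x'. bind2 (bind Y D)
          (\<lambda>y y'. words2 (tens (M x y) (M x' y'))))"
        using Dmul[rule_format, of "coef X" "coef Y"]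
        by (simp add: mulH_coef mulT_coef lext_basis DW words2_tens del: bind2_bind)
      also have "\<dots> = words2 (bind2 (bind X D) (\<lambda>x x'. bind2 (bind Y D)
          (\<lambda>y y'. tens (M x y) (M x' y'))))"
        by (simp add: words2_def)
      finally show ?thesis by (simp only: words2_inj mulV_ret)
    qed
    have Dunit: "lext ?cm ?u = tensl [?u, ?u]"
      using H by (elim conjE)
    have "words2 (bind U D) = words2 (tens U U)"
      using Dunit tensl_coef[of "[U, U]"] by (simp add: lext_basis DW words2_tens)
    then show "bind U D = tens U U" by (simp only: words2_inj)
    have Emul: "\<forall>x\<in>fvec. \<forall>y\<in>fvec. lfun E (mulH ?m x y) = lfun E x * lfun E y"
      using H by (elim conjE)
    show "ev E (mulV M X Y) = ev E X * ev E Y" for X Y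
      using Emul[rule_format, of "coef X" "coef Y"] by (simp add: mulH_coef lfun_coef)
    have "lfun E ?u = 1"
      using H by (elim conjE)
    then show "ev E U = 1" by (simp add: lfun_coef)
    have antipL: "\<forall>a. lext (\<lambda>w. if length w = 2 then mulH ?m (?S (w!0)) (bvec (w!1)) else 0) (?cm a) = scal (E a) ?u"
      using H by (elim conjE)
    have antipR: "\<forall>a. lext (\<lambda>w. if length w = 2 then mulH ?m (bvec (w!0)) (?S (w!1)) else 0) (?cm a) = scal (E a) ?u"
      using H by (elim conjE)
    show "bind2 (D a) (\<lambda>x y. mulV M (A x) (ret y)) = sc (E a) U" for a
      using antipL[rule_format, of a] lext_words2[of "\<lambda>w. mulH ?m (?S (w!0)) (bvec (w!1))" "\<lambda>x y. mulV M (A x) (ret y)" "D a"]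
      by (simp add: bvec_coef mulH_coef scal_coef)
    show "bind2 (D a) (\<lambda>x y. mulV M (ret x) (A y)) = sc (E a) U" for a
      using antipR[rule_format, of a] lext_words2[of "\<lambda>w. mulH ?m (bvec (w!0)) (?S (w!1))" "\<lambda>x y. mulV M (ret x) (A y)" "D a"]
      by (simp add: bvec_coef mulH_coef scal_coef)
  qed
qed

lemma (in conjugation) starV_coef: "starV cnj (\<lambda>a. coef (st a)) (coef X) = coef (starX cnj st X)"
  unfolding starV_def starX_def by (rule alext_coef) simp

lemma hopf_star_coalgebraD:
  assumes "hopf M U D E A" and "conjugation cnj"
    and "hopf_star_coalgebra cnj (\<lambda>a b. coef (M a b)) (coef U) (\<lambda>a. coef (words2 (D a))) E
      (\<lambda>a. coef (A a)) (\<lambda>a. coef (st a))"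
  shows "hopf_star M U D E A cnj st"
proof -
  interpret hopf M U D E A by (rule assms)
  interpret conjugation cnj by (rule assms)
  let ?m = "\<lambda>a b. coef (M a b)" and ?u = "coef U" and ?cm = "\<lambda>a. coef (words2 (D a))" and ?S = "\<lambda>a. coef (A a)"
  let ?star = "starV cnj (\<lambda>a. coef (st a))"
  note H = assms(3)[unfolded hopf_star_coalgebra_def]
  have DW: "bind X (\<lambda>a. words2 (D a)) = words2 (bind X D)" for X
    by (simp add: words2_def)
  show ?thesis
  proof
    have h: "\<forall>x\<in>fvec. ?star (?star x) = x"
      using H by (elim conjE)
    show "starX cnj st (starX cnj st X) = X" for X
      using h[rule_format, of "coef X"] by (simp add: starV_coef)
    have comul: "\<forall>x\<in>fvec. lext ?cm (?star x) = alext cnj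
        (\<lambda>w. if length w = 2 then tensl [coef (st (w!1)), coef (st (w!0))] else 0) (lext ?cm x)"
      using H by (elim conjE)
    show "bind (starX cnj st X) D = bind2 (cv cnj (bind X D)) (\<lambda>x y. tens (st y) (st x))" for X
    proof -
      have "alext cnj (\<lambda>w. if length w = 2 then tensl [coef (st (w!1)), coef (st (w!0))] else 0) (lext ?cm (coef X)) =
          coef (bind (cv cnj (words2 (bind X D))) (\<lambda>w. if length w = 2 then tns [st (w!1), st (w!0)] else 0))"
        unfolding lext_basis DW
      proof (rule alext_coef)
        fix w :: "'a list"
        show "(if length w = 2 then tensl [coef (st (w!1)), coef (st (w!0))] else 0) =
            coef (if length w = 2 then tns [st (w!1), st (w!0)] else 0)"
          using tensl_coef[of "[st (w!1), st (w!0)]"] by (auto simp: fun_eq_iff)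
      qed
      moreover have "cv cnj (words2 P) = words2 (cv cnj P)" for P :: "'a \<times> 'a \<Rightarrow>\<^sub>0 'b"
        by (simp add: words2_def cv_bind2)
      ultimately have "words2 (bind (starX cnj st X) D) =
          bind2 (cv cnj (bind X D)) (\<lambda>x y. words2 (tens (st y) (st x)))"
        using comul[rule_format, of "coef X"]
        by (simp add: starV_coef lext_basis DW words2_tens)
      also have "\<dots> = words2 (bind2 (cv cnj (bind X D)) (\<lambda>x y. tens (st y) (st x)))"
        by (simp add: words2_def)
      finally show ?thesis by (simp only: words2_inj)
    qed
    have h: "\<forall>x\<in>fvec. \<forall>y\<in>fvec. ?star (mulH ?m x y) = mulH ?m (?star x) (?star y)"
      using H by (elim conjE)
    show "starX cnj st (mulV M X Y) = mulV M (starX cnj st X) (starX cnj st Y)" for X Y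
      using h[rule_format, of "coef X" "coef Y"] by (simp add: starV_coef mulH_coef)
    have "?star ?u = ?u"
      using H by (elim conjE)
    then show "starX cnj st U = U" by (simp add: starV_coef)
    have h: "\<forall>x\<in>fvec. lext ?S (?star (lext ?S (?star x))) = x"
      using H by (elim conjE)
    show "bind (starX cnj st (bind (starX cnj st X) A)) A = X" for X
      using h[rule_format, of "coef X"] by (simp add: starV_coef lext_basis)
  qed
qed

section \<open>Maps of dihedral modules and the maps they induce on cycles and boundaries\<close>

lemma
  fixes x y :: "'a \<Rightarrow> 'k::comm_ring_1"
  shows fvec_0: "(0 :: 'a \<Rightarrow> 'k) \<in> fvec"
    and fvec_add: "x \<in> fvec \<Longrightarrow> y \<in> fvec \<Longrightarrow> x + y \<in> fvec"
    and fvec_scal: "x \<in> fvec \<Longrightarrow> scal c x \<in> fvec"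
    by (metis coef_fvec zero_coef, metis fvecE coef_fvec plus_coef, metis fvecE coef_fvec scal_coef)

text \<open>Linearity is asked on all of \<open>fvec\<close>, where the structure maps take their
  values, so it need not be shown that these preserve the carriers.\<close>

locale dihedral_map =
  fixes C1 :: "nat \<Rightarrow> ('c \<Rightarrow> 'k::comm_ring_1) set" and d1 t1 o1
    and C2 :: "nat \<Rightarrow> ('d \<Rightarrow> 'k) set" and d2 t2 o2 and f :: "('c \<Rightarrow> 'k) \<Rightarrow> 'd \<Rightarrow> 'k"
  assumes add: "x \<in> fvec \<Longrightarrow> y \<in> fvec \<Longrightarrow> f (x + y) = f x + f y"
    and scal: "x \<in> fvec \<Longrightarrow> f (scal c x) = scal c (f x)"
    and C1: "x \<in> C1 n \<Longrightarrow> x \<in> fvec"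
    and C2: "x \<in> C1 n \<Longrightarrow> f x \<in> C2 n"
    and face: "0 < n \<Longrightarrow> i \<le> n \<Longrightarrow> x \<in> C1 n \<Longrightarrow> d1 n i x \<in> fvec \<and> f (d1 n i x) = d2 n i (f x)"
    and tau: "x \<in> C1 n \<Longrightarrow> t1 n x \<in> fvec \<and> f (t1 n x) = t2 n (f x)"
    and om: "x \<in> C1 n \<Longrightarrow> o1 n x \<in> fvec \<and> f (o1 n x) = o2 n (f x)"
begin

lemma zero: "f 0 = 0"
  using add[OF fvec_0 fvec_0] by simp

lemma diff:
  assumes "x \<in> fvec" "y \<in> fvec" shows "f (x - y) = f x - f y"
proof -
  have "x - y \<in> fvec"
    using fvec_add[OF assms(1) fvec_scal[OF assms(2), of "-1"]] by (simp add: scal_def fun_diff_def plus_fun_def)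
  then show ?thesis using add[of "x - y" y] assms by simp
qed

lemma sum_closed: "finite A \<Longrightarrow> (\<And>i. i \<in> A \<Longrightarrow> x i \<in> fvec) \<Longrightarrow> (\<Sum>i\<in>A. x i) \<in> fvec \<and> f (\<Sum>i\<in>A. x i) = (\<Sum>i\<in>A. f (x i))"
  by (induction A rule: finite_induct) (auto simp: zero add fvec_0 fvec_add)

lemma boundary:
  assumes "x \<in> C1 n" shows "bdry d1 n x \<in> fvec" "f (bdry d1 n x) = bdry d2 n (f x)"
proof -
  have "0 < n \<Longrightarrow> i \<le> n \<Longrightarrow> scal ((-1)^i) (d1 n i x) \<in> fvec \<and>
      f (scal ((-1)^i) (d1 n i x)) = scal ((-1)^i) (d2 n i (f x))" for i
    using face[OF _ _ assms, of i] by (simp add: fvec_scal scal)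
  then show "bdry d1 n x \<in> fvec" "f (bdry d1 n x) = bdry d2 n (f x)"
    using sum_closed[of "{..n}" "\<lambda>i. scal ((-1)^i) (d1 n i x)"]
    by (auto simp: bdry_def fvec_0 zero intro!: sum.cong)
qed

lemma Iset:
  assumes "x \<in> Iset C1 t1 n" shows "f x \<in> Iset C2 t2 n"
proof -
  obtain z where z: "z \<in> C1 n" "x = z - scal ((-1)^n) (t1 n z)"
    using assms by (auto simp: Iset_def)
  then have "f x = f z - scal ((-1)^n) (t2 n (f z))"
    using tau[OF z(1)] by (simp add: diff C1[OF z(1)] fvec_scal scal)
  then show ?thesis using C2[OF z(1)] by (auto simp: Iset_def)
qed

lemma eigen:
  assumes "x \<in> C1 n" shows "f (yinv o1 n x - scal s x) = yinv o2 n (f x) - scal s (f x)"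
  using om[OF assms] C1[OF assms] by (simp add: yinv_def diff fvec_scal scal)

lemma dZ: "f ` dZ C1 d1 t1 o1 s n \<subseteq> dZ C2 d2 t2 o2 s n"
proof
  fix y assume "y \<in> f ` dZ C1 d1 t1 o1 s n"
  then obtain x where x: "y = f x" "x \<in> C1 n" "yinv o1 n x - scal s x \<in> Iset C1 t1 n" "bdry d1 n x \<in> Iset C1 t1 (n - 1)"
    by (auto simp: dZ_def)
  then show "y \<in> dZ C2 d2 t2 o2 s n"
    using Iset[OF x(3)] Iset[OF x(4)] C2[OF x(2)] by (simp add: dZ_def eigen boundary)
qed

lemma dB: "f ` dB C1 d1 t1 o1 s n \<subseteq> dB C2 d2 t2 o2 s n"
proof
  fix y assume "y \<in> f ` dB C1 d1 t1 o1 s n"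
  then obtain x w where x: "y = f x" "x \<in> C1 n" "w \<in> C1 (Suc n)"
      "yinv o1 (Suc n) w - scal s w \<in> Iset C1 t1 (Suc n)" "x - bdry d1 (Suc n) w \<in> Iset C1 t1 n"
    by (auto simp: dB_def)
  have "yinv o2 (Suc n) (f w) - scal s (f w) \<in> Iset C2 t2 (Suc n)"
    using Iset[OF x(4)] by (simp add: eigen x)
  moreover have "f x - bdry d2 (Suc n) (f w) \<in> Iset C2 t2 n"
    using Iset[OF x(5)] by (simp add: diff C1[OF x(2)] boundary x)
  ultimately show "y \<in> dB C2 d2 t2 o2 s n"
    using x(1-3) C2 by (auto simp: dB_def)
qed

end

section \<open>The structure maps of both complexes in terms of vectors\<close>

lemma lin_comp:
  assumes "lin L" "lin G" shows "lin (\<lambda>X. L (G X))"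
proof (rule linI)
  show "L (G X) = bind X (\<lambda>a. L (G (ret a)))" for X
    by (subst linD[OF assms(2)]) (rule lin_bind[OF assms(1)])
qed

text \<open>Membership in a tensor power, for vectors; images of the comparison maps must lie in the
  correct carriers.\<close>

definition lenV :: "nat \<Rightarrow> ('b list \<Rightarrow>\<^sub>0 'k::comm_ring_1) \<Rightarrow> bool" where
  "lenV n W \<longleftrightarrow> (\<forall>w\<in>Poly_Mapping.keys W. length w = n)"

named_theorems lenV_intros

lemma lenV_bind: 
  assumes "\<And>a. a \<in> Poly_Mapping.keys X \<Longrightarrow> lenV n (F a)" shows "lenV n (bind X F)"
  unfolding lenV_def
proof
  fix w assume "w \<in> Poly_Mapping.keys (bind X F)"
  then have "(\<Sum>a\<in>Poly_Mapping.keys X. coef X a * coef (F a) w) \<noteq> 0"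
    by (simp add: in_keys_iff coef_bind)
  then obtain a where "a \<in> Poly_Mapping.keys X" "coef X a * coef (F a) w \<noteq> 0"
    by (meson sum.not_neutral_contains_not_neutral)
  then show "length w = n" using assms[of a] by (auto simp: lenV_def in_keys_iff)
qed

lemma lenV_ret [lenV_intros]: "length w = n \<Longrightarrow> lenV n (ret w)"
  by (auto simp: lenV_def in_keys_iff coef_ret split: if_splits)

lemma lenV_sc [lenV_intros]: "lenV n W \<Longrightarrow> lenV n (sc c W)"
  by (auto simp: lenV_def in_keys_iff)

lemma lenV_consV [lenV_intros]: "lenV n W \<Longrightarrow> lenV (Suc n) (consV X W)"
  by (auto simp: consV_def lenV_def simp del: consV_bind
      intro!: lenV_bind[unfolded lenV_def] lenV_ret[unfolded lenV_def])

lemma (in hopf) lenV_coact: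
  "(\<And>p v. length v = length w \<Longrightarrow> lenV n (F p v)) \<Longrightarrow> lenV n (coact (ret w) F)"
proof (induction w arbitrary: F)
  case (Cons a w)
  have "lenV n (coact (ret w) (\<lambda>p v. bind (ret x \<star> ret p) (\<lambda>q. F q (y # v))))" for x y
    by (rule Cons.IH, rule lenV_bind) (simp add: Cons.prems)
  then show ?case by (simp add: coact_Cons sw_def bind2_def lenV_bind)
qed (simp add: lenV_bind)

lemma tensl_Cons_bvec: "tensl (coef X # map bvec w) = coef (consV X (ret w))"
  using tensl_coef[of "X # map ret w"] by (simp add: bvec_coef[abs_def] comp_def)

lemma faceA_coef: "faceA (\<lambda>a b. coef (M a b)) n i (coef X) = coef (bind X (faceA' M n i))"
  unfolding faceA_def
proof (rule lext_coef)
  fix w :: "'a list"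
  have "tns (map ret (take i w) @ M (w ! i) (w ! Suc i) # map ret (drop (i + 2) w)) = merge M i w"
    by (simp add: tns_append merge_def consV_def bind_commute del: consV_bind)
  moreover have "tns (M (w ! n) (w ! 0) # map ret (take (n - 1) (drop 1 w))) =
      consV (mulV M (ret (w ! n)) (ret (w ! 0))) (ret (take (n - 1) (drop 1 w)))"
    by (simp add: mulV_ret)
  ultimately show "(if i < n
      then tensl (map bvec (take i w) @ [coef (M (w ! i) (w ! Suc i))] @ map bvec (drop (i + 2) w))
      else tensl (coef (M (w ! n) (w ! 0)) # map bvec (take (n - 1) (drop 1 w)))) = coef (faceA' M n i w)"
    using tensl_coef[of "map ret (take i w) @ M (w ! i) (w ! Suc i) # map ret (drop (i + 2) w)"]
      tensl_coef[of "M (w ! n) (w ! 0) # map ret (take (n - 1) (drop 1 w))"]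
    by (simp add: faceA'_def bvec_coef[abs_def] comp_def)
qed

lemma faceH_coef: "faceH (\<lambda>a b. coef (M a b)) E n i (coef X) = coef (bind X (faceH' M E n i))"
  unfolding faceH_def
proof (rule lext_coef)
  fix w :: "'a list"
  have "tns (map ret (take (i - 1) w) @ M (w ! (i - 1)) (w ! i) # map ret (drop (i + 1) w)) = merge M (i - 1) w"
    if "0 < i"
    using that by (simp add: tns_append merge_def consV_def bind_commute del: consV_bind)
  then show "(if i = 0 then scal (E (w!0)) (bvec (tl w))
      else if i < n then
        tensl (map bvec (take (i - 1) w) @ [coef (M (w!(i - 1)) (w!i))] @ map bvec (drop (i + 1) w))
      else scal (E (last w)) (bvec (butlast w))) = coef (faceH' M E n i w)"
    using tensl_coef[of "map ret (take (i - 1) w) @ M (w ! (i - 1)) (w ! i) # map ret (drop (i + 1) w)"]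
    by (simp add: faceH'_def bvec_coef[abs_def] scal_coef comp_def)
qed

lemma tauA_coef: "tauA n (coef X) = coef (bind X tauA')"
  unfolding tauA_def by (rule lext_coef) (simp add: tauA'_def bvec_coef)

context hopf
begin

lemma foldr_mulH: "foldr (mulH (\<lambda>a b. coef (M a b))) (map bvec ps) (coef U) = coef (foldr mul (map ret ps) U)"
  by (induction ps) (auto simp: bvec_coef mulH_coef)

text \<open>The interleaved word on which \<open>tauH\<close> operates: even positions hold first
  legs, odd positions second legs.\<close>

definition splits :: "'b list \<Rightarrow> 'b list \<Rightarrow>\<^sub>0 'k" where
  "splits w = foldr (\<lambda>a W. sw (ret a) (\<lambda>x y. bind W (\<lambda>v. ret (x # y # v)))) w (ret [])"

lemma foldr_tprod: "foldr tprod (map (\<lambda>a. coef (words2 (D a))) w) (bvec []) = coef (splits w)"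
  by (induction w) (simp_all add: splits_def bvec_coef tprod_coef, simp add: sw_def)

text \<open>Separating even from odd positions recovers the coaction. The product of first legs is a
  vector and not a basis element, hence the linearity of \<open>F\<close> in it.\<close>

lemma bind_splits:
  assumes "\<And>v. lin (\<lambda>X. F X v)"
  shows "bind (splits w) (\<lambda>v. if length v = 2 * length w
      then F (foldr mul (map ret (map (\<lambda>j. v ! (2 * j)) [0..<length w])) U)
        (map (\<lambda>j. v ! (2 * j + 1)) [0..<length w]) else 0) =
    coact (ret w) (\<lambda>p v. F (ret p) v)"
  using assms
proof (induction w arbitrary: F)
  case Nil
  then show ?case by (simp add: splits_def) (rule linD)
next
  case (Cons a w)
  have upt: "map h [0..<Suc n] = h 0 # map (\<lambda>j. h (Suc j)) [0..<n]" for h :: "nat \<Rightarrow> 'b" and n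
    by (simp add: upt_conv_Cons map_Suc_upt[symmetric] comp_def del: upt_Suc)
  \<comment> \<open>The induction hypothesis is used for \<open>F\<close> with \<open>x\<close>
    multiplied on and \<open>y\<close> prefixed, which is again linear.\<close>
  have "bind (splits w) (\<lambda>v. if length v = 2 * length w
      then F (ret x \<star> foldr mul (map ret (map (\<lambda>j. v ! (2 * j)) [0..<length w])) U)
        (y # map (\<lambda>j. v ! (2 * j + 1)) [0..<length w]) else 0) =
      coact (ret w) (\<lambda>p v. F (ret x \<star> ret p) (y # v))" for x y
    by (rule Cons.IH[of "\<lambda>X v. F (ret x \<star> X) (y # v)"]) (rule lin_comp[OF Cons.prems], intro lin_intros)
  moreover have "bind X (\<lambda>q. F (ret q) v) = F X v" for X v
    by (rule linD[OF Cons.prems, symmetric])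
  ultimately show ?case
    by (simp add: coact_Cons splits_def upt del: upt_Suc map_map cong: if_cong)
qed

lemma tauH_coef:
  assumes len: "\<And>w. w \<in> Poly_Mapping.keys X \<Longrightarrow> length w = n"
  shows "tauH (\<lambda>a b. coef (M a b)) (coef U) (\<lambda>a. coef (words2 (D a))) E (\<lambda>a. coef (A a)) (coef g) n (coef X) =
    coef (bind X (tauH' g))"
proof (cases "n = 0")
  case True
  then have "bind X (tauH' g) = bind X ret"
    using len by (intro bind_cong_keys) (auto simp: tauH'_def)
  then show ?thesis using True by (simp add: tauH_def)
next
  case False
  let ?F = "\<lambda>X v. sc (E (last v)) (consV (g \<star> S X) (ret (butlast v)))"
  let ?G = "\<lambda>v. if length v = 2 * n
    then ?F (foldr mul (map ret (map (\<lambda>j. v ! (2 * j)) [0..<n])) U) (map (\<lambda>j. v ! (2 * j + 1)) [0..<n]) else 0"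
  have S: "lext (\<lambda>a. coef (A a)) (coef Y) = coef (S Y)" for Y
    by (simp add: lext_basis S_def)
  have "tauH (\<lambda>a b. coef (M a b)) (coef U) (\<lambda>a. coef (words2 (D a))) E (\<lambda>a. coef (A a)) (coef g) n (coef X) =
      coef (bind (bind X splits) ?G)"
    unfolding tauH_def if_not_P[OF False] foldr_tprod lext_basis Let_def
  proof (rule lext_coef)
    fix v :: "'b list"
    let ?ps = "map (\<lambda>j. v ! (2 * j)) [0..<n]" and ?qs = "map (\<lambda>j. v ! (2 * j + 1)) [0..<n]"
    have "tensl (mulH (\<lambda>a b. coef (M a b)) (coef g) (lext (\<lambda>a. coef (A a))
          (foldr (mulH (\<lambda>a b. coef (M a b))) (map bvec ?ps) (coef U))) # map bvec (butlast ?qs)) =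
        coef (consV (g \<star> S (foldr mul (map ret ?ps) U)) (ret (butlast ?qs)))"
      unfolding foldr_mulH S mulH_coef by (rule tensl_Cons_bvec)
    then show "(if length v = 2 * n then scal (E (last ?qs)) (tensl (mulH (\<lambda>a b. coef (M a b)) (coef g)
          (lext (\<lambda>a. coef (A a)) (foldr (mulH (\<lambda>a b. coef (M a b))) (map bvec ?ps) (coef U)))
          # map bvec (butlast ?qs))) else 0) = coef (?G v)"
      by (simp only: scal_coef if_distrib[of coef] zero_coef)
  qed
  \<comment> \<open>Words in the support have length \<open>n > 0\<close>, so the length test in
    \<open>bind_splits\<close> matches and \<open>tauH'\<close> is in its nonempty case.\<close>
  also have "bind (bind X splits) ?G = bind X (tauH' g)"
    unfolding bind_assoc
  proof (rule bind_cong_keys)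
    fix w assume "w \<in> Poly_Mapping.keys X"
    then have "length w = n" by (rule len)
    moreover from this have "w \<noteq> []" using False by auto
    moreover have "lin (\<lambda>X. ?F X v)" for v by (intro lin_intros)
    ultimately show "bind (splits w) ?G = tauH' g w"
      using bind_splits[of ?F w] by (simp add: tauH'_def cong: if_cong)
  qed
  finally show ?thesis .
qed

end

context hopf_star
begin

lemma star_S_coef: "starV cnj (\<lambda>a. coef (st a)) (lext (\<lambda>a. coef (A a)) (bvec a)) = coef (bar (ret a))"
  by (simp add: bvec_coef lext_basis starV_coef bar_def S_def)

lemma tns_rev: "tns (map (\<lambda>a. bar (ret a)) (rev w)) = omH w"
  by (induction w) (simp_all add: tns_append, simp add: consV_def del: consV_bind)

lemma omegaA_coef: "omegaA cnj (\<lambda>a. coef (A a)) (\<lambda>a. coef (st a)) n (coef X) = coef (bind (conj X) omA)"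
  unfolding omegaA_def star_S_coef
proof (rule alext_coef)
  fix w
  show "tensl (map (\<lambda>a. coef (bar (ret a))) (hd w # rev (tl w))) = coef (omA w)"
    using tensl_coef[of "map (\<lambda>a. bar (ret a)) (hd w # rev (tl w))"] tns_rev[of "tl w"]
    by (simp add: omA_def comp_def)
qed

text \<open>\<open>S\<close> has the left inverse \<open>\<lambda>X. star (S (star X))\<close>,
  hence is injective, and \<open>S (bar X) = star X\<close> identifies the preimage.\<close>

lemma the_inv_S: "the_inv_into fvec (lext (\<lambda>a. coef (A a))) (starV cnj (\<lambda>a. coef (st a)) (bvec a)) = coef (bar (ret a))"
proof (rule the_inv_into_f_eq)
  have inj: "X = Y" if "S X = S Y" for X Y
    using arg_cong[OF that, of "\<lambda>Z. star (S (star Z))"] by (simp add: S_star star_star)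
  show "inj_on (lext (\<lambda>a. coef (A a))) fvec"
  proof (intro inj_onI)
    fix x y :: "'b \<Rightarrow> 'k"
    assume xy: "x \<in> fvec" "y \<in> fvec" and eq: "lext (\<lambda>a. coef (A a)) x = lext (\<lambda>a. coef (A a)) y"
    obtain X where "x = coef X" using fvecE[OF xy(1)] .
    moreover obtain Y where "y = coef Y" using fvecE[OF xy(2)] .
    ultimately show "x = y" using eq inj[of X Y] by (simp add: lext_basis S_def)
  qed
  have "lext (\<lambda>a. coef (A a)) (coef (bar (ret a))) = coef (S (star (S (ret a))))"
    by (simp only: lext_basis S_def bar_def)
  then show "lext (\<lambda>a. coef (A a)) (coef (bar (ret a))) = starV cnj (\<lambda>a. coef (st a)) (bvec a)"
    by (simp add: S_star bvec_coef starV_coef)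
qed simp

lemma omegaH_coef: "omegaH cnj (\<lambda>a. coef (A a)) (\<lambda>a. coef (st a)) n (coef X) = coef (bind (conj X) omH)"
  unfolding omegaH_def the_inv_S
proof (rule alext_coef)
  fix w
  show "tensl (map (\<lambda>a. coef (bar (ret a))) (rev w)) = coef (omH w)"
    using tensl_coef[of "map (\<lambda>a. bar (ret a)) (rev w)"] tns_rev[of w] by (simp add: comp_def)
qed

section \<open>The splitting of dihedral homology\<close>

lemma bind_cong_op:
  assumes "\<And>w. w \<in> Poly_Mapping.keys X \<Longrightarrow> bind (F w) G = bind (F' w) G'"
  shows "bind (bind X F) G = bind (bind X F') G'"
  unfolding bind_assoc using assms by (rule bind_cong_keys)

lemma keys_conj: "Poly_Mapping.keys (conj X) = Poly_Mapping.keys X"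
  by (auto simp: in_keys_iff) (metis cnj_0 cnj_cnj)

theorem direct_summand:
  fixes g gi :: "'b \<Rightarrow>\<^sub>0 'k" and s :: 'k
  assumes Dg: "bind g D = tens g g" and Eg: "ev E g = 1"
    and inv: "g \<star> gi = U" "gi \<star> g = U" and star_g: "star g = gi"
    and trace: "\<And>X Y. ev T (X \<star> Y) = ev T (Y \<star> X)"
    and T_inv: "\<And>X. sw X (\<lambda>x y. sc (T x) (ret y)) = sc (ev T X) g"
    and nz: "ev T g \<noteq> 0" and two: "(2 :: 'k) \<noteq> 0"
  defines "dH \<equiv> faceH (\<lambda>a b. coef (M a b)) E"
    and "tH \<equiv> tauH (\<lambda>a b. coef (M a b)) (coef U) (\<lambda>a. coef (words2 (D a))) E (\<lambda>a. coef (A a)) (coef g)"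
    and "oH \<equiv> omegaH cnj (\<lambda>a. coef (A a)) (\<lambda>a. coef (st a))"
    and "dA \<equiv> faceA (\<lambda>a b. coef (M a b))"
    and "oA \<equiv> omegaA cnj (\<lambda>a. coef (A a)) (\<lambda>a. coef (st a))"
  shows "quot_direct_summand cnj (dZ CH dH tH oH s n) (dB CH dH tH oH s n)
    (dZ CA dA tauA oA s n) (dB CA dA tauA oA s n)"
proof -
  have star_gi: "star gi = g" using star_star[of g] by (simp add: star_g)
  have "S g \<star> g = U"
    using sw_antipL[of "\<lambda>Z. Z" g] by (simp add: lin_intros Eg) (simp add: sw_def Dg)
  then have Sg: "S g = gi"
    using mul_assoc[of "S g" g gi] by (simp add: inv)
  have bar_g: "bar g = g" by (simp add: bar_def Sg star_gi)
  \<comment> \<open>\<open>R\<close> replaces \<open>T\<close> from here on, as the retraction has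
    to commute with the involutions.\<close>
  obtain R where R: "\<And>X Y. ev R (X \<star> Y) = ev R (Y \<star> X)" 
      "\<And>X. sw X (\<lambda>x y. sc (R x) (ret y)) = sc (ev R X) g"
      "ev R g = 1" "\<And>X. ev R (bar X) = cnj (ev R X)"
    using real_trace[OF trace T_inv nz bar_g two] by blast
  have sq: "g \<star> S (g \<star> S X) = X" for X
    by (rule antipode_square[OF R(1-3)])
  have bar_gS: "bar (g \<star> S X) = g \<star> S (bar X)" for X
    by (rule bar_group_like[OF sq Sg star_gi inv])
  let ?i = "lext (\<lambda>w. coef (theta g w))" and ?p = "lext (\<lambda>w. coef (gamma R w))"
  have CH: "x \<in> CH n \<Longrightarrow> \<exists>X. x = coef X \<and> (\<forall>w \<in> Poly_Mapping.keys X. length w = n)" for x :: "'b list \<Rightarrow> 'k" and n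
    unfolding CH_def by (metis TP_E)
  have CA: "x \<in> CA n \<Longrightarrow> \<exists>X. x = coef X \<and> (\<forall>w \<in> Poly_Mapping.keys X. length w = Suc n)" for x :: "'b list \<Rightarrow> 'k" and n
    unfolding CA_def by (metis TP_E)
  have lin: "y \<in> fvec \<Longrightarrow> lext (\<lambda>w. coef (F w)) (x + y) = lext (\<lambda>w. coef (F w)) x + lext (\<lambda>w. coef (F w)) y"
      "lext (\<lambda>w. coef (F w)) (scal c x) = scal c (lext (\<lambda>w. coef (F w)) x)"
    if x: "x \<in> fvec" for x y :: "'b list \<Rightarrow> 'k" and c and F :: "'b list \<Rightarrow> 'b list \<Rightarrow>\<^sub>0 'k"
  proof -
    obtain X where X: "x = coef X" using fvecE[OF x] .
    show "lext (\<lambda>w. coef (F w)) (scal c x) = scal c (lext (\<lambda>w. coef (F w)) x)"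
      by (simp add: X scal_coef lext_basis)
    assume y: "y \<in> fvec"
    obtain Y where Y: "y = coef Y" using fvecE[OF y] .
    show "lext (\<lambda>w. coef (F w)) (x + y) = lext (\<lambda>w. coef (F w)) x + lext (\<lambda>w. coef (F w)) y"
      by (simp add: X Y plus_coef lext_basis bind_add)
  qed
  have theta_om': "bind (omH w) (theta g) = bind (conj (theta g w)) omA" for w
    by (rule theta_om[OF bar_gS])
  interpret i: dihedral_map CH dH tH oH CA dA tauA oA ?i
  proof
    fix x :: "'b list \<Rightarrow> 'k" and n i
    assume x: "x \<in> CH n"
    obtain X where X: "x = coef X" "\<And>w. w \<in> Poly_Mapping.keys X \<Longrightarrow> length w = n" using CH[OF x] by auto
    show "x \<in> fvec" by (simp add: X)
    have "lenV (Suc n) (bind X (theta g))"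
      unfolding theta_def by (intro lenV_bind lenV_coact lenV_intros) (simp add: X)
    then show "?i x \<in> CA n" by (simp add: X(1) lext_basis CA_def TP_iff lenV_def)
    show "tH n x \<in> fvec \<and> ?i (tH n x) = tauA n (?i x)"
      using theta_tau[OF sq Dg] by (simp add: X(1) tH_def tauH_coef[OF X(2)] lext_basis tauA_coef)
    show "oH n x \<in> fvec \<and> ?i (oH n x) = oA n (?i x)"
      by (simp add: X(1) oH_def oA_def omegaH_coef omegaA_coef lext_basis cv_bind theta_om')
    assume "0 < n" "i \<le> n"
    then show "dH n i x \<in> fvec \<and> ?i (dH n i x) = dA n i (?i x)"
      by (simp add: X(1) dH_def dA_def faceH_coef faceA_coef lext_basis)
        (intro bind_cong_keys theta_face[OF X(2) _ _ sq Dg Eg])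
  qed (auto intro: lin)
  interpret p: dihedral_map CA dA tauA oA CH dH tH oH ?p
  proof
    fix x :: "'b list \<Rightarrow> 'k" and n i
    assume x: "x \<in> CA n"
    obtain X where X: "x = coef X" "\<And>w. w \<in> Poly_Mapping.keys X \<Longrightarrow> length w = Suc n" using CA[OF x] by auto
    have ne: "w \<in> Poly_Mapping.keys X \<Longrightarrow> w \<noteq> []" for w using X(2) by fastforce
    have ne': "w \<in> Poly_Mapping.keys (conj X) \<Longrightarrow> w \<noteq> []" for w using ne by (simp add: keys_conj)
    show "x \<in> fvec" by (simp add: X)
    have len: "lenV n (bind X (gamma R))"
      unfolding gamma_def by (intro lenV_bind lenV_coact lenV_intros) (simp add: X)
    then show "?p x \<in> CH n" by (simp add: X(1) lext_basis CH_def TP_iff lenV_def)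
    \<comment> \<open>The identity is available for nonempty words, and the support of
      \<open>X\<close> consists of such words.\<close>
    have "bind (bind X tauA') (gamma R) = bind (bind X (gamma R)) (tauH' g)"
      by (rule bind_cong_op, rule gamma_tau[OF ne R(1,2)])
    \<comment> \<open>\<open>tauH_coef\<close> requires words of length \<open>n\<close>, hence the
      length bound for the image under \<open>gamma\<close>.\<close>
    moreover have "tH n (coef (bind X (gamma R))) = coef (bind (bind X (gamma R)) (tauH' g))"
      unfolding tH_def using len by (intro tauH_coef) (simp add: lenV_def)
    ultimately show "tauA n x \<in> fvec \<and> ?p (tauA n x) = tH n (?p x)"
      by (simp add: X(1) lext_basis tauA_coef del: bind_assoc)
    have "bind (bind (conj X) omA) (gamma R) = bind (bind (conj X) (\<lambda>w. conj (gamma R w))) omH"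
      by (rule bind_cong_op, rule gamma_om[OF ne' R(1,4)])
    then show "oA n x \<in> fvec \<and> ?p (oA n x) = oH n (?p x)"
      by (simp add: X(1) oH_def oA_def omegaH_coef omegaA_coef lext_basis cv_bind del: bind_assoc)
    assume n: "0 < n" "i \<le> n"
    have "bind (bind X (faceA' M n i)) (gamma R) = bind (bind X (gamma R)) (faceH' M E n i)"
      by (rule bind_cong_op, rule gamma_face[OF X(2) n R(1)])
    then show "dA n i x \<in> fvec \<and> ?p (dA n i x) = dH n i (?p x)"
      by (simp add: X(1) dH_def dA_def faceH_coef faceA_coef lext_basis del: bind_assoc)
  qed (auto intro: lin)
  have fv: "dZ CH dH tH oH s n \<subseteq> fvec" "dZ CA dA tauA oA s n \<subseteq> fvec"
    using i.C1 p.C1 by (auto simp: dZ_def)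
  have pi: "?p (?i z) = z" if z: "z \<in> fvec" for z
  proof -
    obtain Z where "z = coef Z" using fvecE[OF z] .
    then show ?thesis by (simp add: lext_basis gamma_theta[OF R(3)])
  qed
  \<comment> \<open>By \<open>pi\<close> the difference \<open>?p (?i z) - z\<close> is exactly 0,
    so the retraction condition asks only that 0 be a boundary.\<close>
  have B0: "0 \<in> dB CH dH tH oH s n"
  proof -
    have c0: "coef 0 = (0 :: 'b list \<Rightarrow> 'k)" by (rule zero_coef[symmetric])
    have s0: "scal c 0 = (0 :: 'b list \<Rightarrow> 'k)" for c :: 'k by (auto simp: scal_def)
    have 0: "(0 :: 'b list \<Rightarrow> 'k) \<in> CH n" for n by (simp add: CH_def TP_def fsupp_def)
    have t0: "tH n 0 = 0" and o0: "oH n 0 = 0" and d0: "dH n i 0 = 0" for n i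
      using tauH_coef[of 0 n g] omegaH_coef[of n 0] faceH_coef[of M E n i 0]
      by (simp_all add: tH_def oH_def dH_def c0)
    have I0: "0 \<in> Iset CH tH n" for n
      unfolding Iset_def by (intro CollectI exI[of _ 0] conjI 0) (simp add: t0 s0)
    have "yinv oH n 0 = 0" "bdry dH n 0 = 0" for n
      by (simp_all add: yinv_def bdry_def o0 d0 s0)
    then show ?thesis
      unfolding dB_def by (intro CollectI conjI bexI[of _ 0] 0) (simp_all add: I0 s0)
  qed
  show ?thesis
    unfolding quot_direct_summand_def k0lin_def
  proof (rule exI[of _ ?i], rule exI[of _ ?p], intro conjI i.dZ i.dB p.dZ p.dB ballI allI impI)
    fix z assume "z \<in> dZ CH dH tH oH s n"
    then show "?p (?i z) - z \<in> dB CH dH tH oH s n"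
      using pi[of z] fv(1) B0 by auto
  qed (use fv in \<open>auto intro!: lin\<close>)
qed

end

section \<open>Conclusion for the given structure constants\<close>

lemma coef_Abs: "x \<in> fvec \<Longrightarrow> coef (Poly_Mapping.Abs_poly_mapping x) = x"
  by (simp add: fvec_def fsupp_def)

theorem theorem5p2:
  fixes cnj :: "'k::field_char_0 \<Rightarrow> 'k" and ii :: 'k
    and m :: "'b \<Rightarrow> 'b \<Rightarrow> 'b \<Rightarrow> 'k" and u :: "'b \<Rightarrow> 'k"
    and cm :: "'b \<Rightarrow> 'b list \<Rightarrow> 'k" and e :: "'b \<Rightarrow> 'k"
    and S st :: "'b \<Rightarrow> 'b \<Rightarrow> 'k"
    and sigma sinv Tr :: "'b \<Rightarrow> 'k"
    and s :: 'k and n :: nat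
  assumes "conj_field cnj ii"
    and "hopf_algebra m u cm e S"
    and "modular_pair m u cm e S sigma sinv"
    and "sigma_trace m cm sigma Tr"
    and "lfun Tr sigma \<noteq> 0"
    and "hopf_star_coalgebra cnj m u cm e S st"
    and "starV cnj st sigma = sinv"
    and "s = 1 \<or> s = -1"
  shows "quot_direct_summand cnj
           (dZ CH (faceH m e) (tauH m u cm e S sigma) (omegaH cnj S st) s n)
           (dB CH (faceH m e) (tauH m u cm e S sigma) (omegaH cnj S st) s n)
           (dZ CA (faceA m) tauA (omegaA cnj S st) s n)
           (dB CA (faceA m) tauA (omegaA cnj S st) s n)"
proof -
  let ?vec = "Poly_Mapping.Abs_poly_mapping"
  have fv: "\<And>a b. m a b \<in> fvec" "u \<in> fvec" "\<And>a. cm a \<in> TP 2" "\<And>a. S a \<in> fvec"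
    using assms(2) by (simp_all add: hopf_algebra_def)
  have fv': "\<And>a. st a \<in> fvec" "sigma \<in> fvec" "sinv \<in> fvec"
    using assms(3,6) by (simp_all add: hopf_star_coalgebra_def modular_pair_def)
  define M where "M = (\<lambda>a b. ?vec (m a b))"
  define U where "U = ?vec u"
  define A where "A = (\<lambda>a. ?vec (S a))"
  define st' where "st' = (\<lambda>a. ?vec (st a))"
  define g where "g = ?vec sigma"
  define gi where "gi = ?vec sinv"
  \<comment> \<open>The values of \<open>cm\<close> are supported on words of length two, so the
    form on pairs is chosen through \<open>words2E\<close> instead of \<open>?vec\<close>.\<close>
  have "\<exists>P. cm a = coef (words2 P)" for a
    using words2E[OF fv(3)[of a]] by blast
  then obtain D where "\<And>a. cm a = coef (words2 (D a))" by metis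
  then have cm: "cm = (\<lambda>a. coef (words2 (D a)))" by (rule ext)
  have m: "m = (\<lambda>a b. coef (M a b))" and u: "u = coef U" and S: "S = (\<lambda>a. coef (A a))"
    and st: "st = (\<lambda>a. coef (st' a))" and g: "sigma = coef g" and gi: "sinv = coef gi"
    by (simp_all add: M_def U_def A_def st'_def g_def gi_def coef_Abs fv fv')
  interpret conjugation cnj
    using assms(1) by unfold_locales (auto simp: conj_field_def)
  interpret hopf_star M U D e A cnj st'
    using hopf_star_coalgebraD hopf_algebraD conjugation_axioms assms(2,6)
    unfolding m u S st cm by blast
  have DW: "bind X (\<lambda>a. words2 (D a)) = words2 (bind X D)" for X
    by (simp add: words2_def)
  note mp = assms(3)[unfolded modular_pair_def m u cm g gi]
  have "lext (\<lambda>a. coef (words2 (D a))) (coef g) = tensl [coef g, coef g]"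
    using mp by (elim conjE)
  then have "words2 (bind g D) = words2 (tens g g)"
    using tensl_coef[of "[g, g]"] by (simp add: lext_basis DW words2_tens)
  then have Dg: "bind g D = tens g g" by (simp only: words2_inj)
  have Eg: "ev e g = 1" and inv: "mulV M g gi = U" "mulV M gi g = U"
    using mp by (simp_all add: lfun_coef mulH_coef)
  have star_g: "starX cnj st' g = gi"
    using assms(7) by (simp add: st g gi starV_coef)
  note tr = assms(4)[unfolded sigma_trace_def m cm g]
  have trace: "ev Tr (mulV M X Y) = ev Tr (mulV M Y X)" for X Y
    using tr[THEN conjunct2, rule_format, of "coef X" "coef Y"] by (simp add: mulH_coef lfun_coef)
  have "bind2 (D a) (\<lambda>x y. sc (Tr x) (ret y)) = sc (Tr a) g" for a
    using tr[THEN conjunct1, rule_format, of a]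
      lext_words2[of "\<lambda>w. scal (Tr (w ! 0)) (bvec (w ! 1))" "\<lambda>x y. sc (Tr x) (ret y)" "D a"]
    by (simp add: bvec_coef scal_coef)
  then have T_inv: "sw X (\<lambda>x y. sc (Tr x) (ret y)) = sc (ev Tr X) g" for X
    by (simp add: sw_def bind_sc_fun)
  have "ev Tr g \<noteq> 0" using assms(5) by (simp add: g lfun_coef)
  from direct_summand[OF Dg Eg inv star_g trace T_inv this, of s n]
  show ?thesis unfolding m u cm S st g by simp
qed

end
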